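(* Let $W$ be a finite reflection group with set of simple reflections $S$ and let $d=|S|$ be its rank. Then, for $d\ge 1$, $$\mathrm{PersistS}(W)\ \ge\ \frac{1}{d+1}\sum_{s\in S}\frac{|W|}{|W_s|}\left(|W|-|W_s|\right)\mathrm{PersistS}(W_s),$$ with base case $\mathrm{PersistS}(\{e\})=1$.
   Context: $W$ is a finite group generated by orthogonal reflections of a Euclidean space $V$, with root system $\Phi$; $B$ is a fixed open fundamental chamber (a connected component of the complement of the hyperplanes $\alpha^\perp$, $\alpha\in\Phi$), and $S$ is the set of simple reflections for $B$, i.e. the reflections in the walls of $B$. For $\mathbf{a}\in B$, the polytope $P^W(\mathbf{a})=\mathrm{conv}(W\cdot\mathbf{a})$ has dimension $d=|S|$. For $s\in S$, $W_s$ denotes the maximal parabolic subgroup of $W$ generated by $S\setminus\{s\}$, itself a finite reflection group of rank $d-1$. A subset $\mathcal{S}\subseteq W$ of size $d+1$ is a persistent simplex if $\mathrm{conv}(\mathcal{S}\cdot\mathbf{a})$ is a $d$-dimensional simplex for every $\mathbf{a}\in B$. $\mathrm{PersistS}(W)$ denotes the number of subsets $\mathcal{S}\subseteq W$ that are persistent simplices (and $\mathrm{PersistS}(W_s)$ is the same quantity for the reflection group $W_s$, with its own rank and its own fundamental chamber). *)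

theory Defs
  imports "HOL-Analysis.Analysis" "HOL-Algebra.Bij" "HOL-Algebra.Generated_Groups"
begin

text \<open>
  Elements of a reflection group are represented as maps \<open>V \<rightarrow> V\<close> on a Euclidean space, and the
  groups are taken inside the group of all bijections of \<open>V\<close>. The action on \<open>V\<close> need not be
  essential, so a group and its parabolic subgroups live on the same space.
\<close>

definition reflection :: "'a::euclidean_space \<Rightarrow> 'a \<Rightarrow> 'a" where
  "reflection \<alpha> x = x - (2 * (x \<bullet> \<alpha>) / (\<alpha> \<bullet> \<alpha>)) *\<^sub>R \<alpha>"

definition group_generated :: "('a::euclidean_space \<Rightarrow> 'a) set \<Rightarrow> ('a \<Rightarrow> 'a) set" where
  "group_generated R = generate (BijGroup UNIV) R"

definition finite_reflection_group :: "('a::euclidean_space \<Rightarrow> 'a) set \<Rightarrow> bool" where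
  "finite_reflection_group W \<longleftrightarrow>
     finite W \<and> (\<exists>A. 0 \<notin> A \<and> W = group_generated (reflection ` A))"

text \<open>
  The root system, normalised to unit vectors: both unit normals of every reflecting hyperplane.
  Below, only the hyperplanes orthogonal to roots and the reflections in them are used, and these
  do not depend on the normalisation.
\<close>

definition roots :: "('a::euclidean_space \<Rightarrow> 'a) set \<Rightarrow> 'a set" where
  "roots W = {\<alpha>. norm \<alpha> = 1 \<and> reflection \<alpha> \<in> W}"

definition root_hyperplane :: "'a::euclidean_space \<Rightarrow> 'a set" where
  "root_hyperplane \<alpha> = {x. \<alpha> \<bullet> x = 0}"

definition chamber :: "('a::euclidean_space \<Rightarrow> 'a) set \<Rightarrow> 'a set \<Rightarrow> bool" where
  "chamber W B \<longleftrightarrow> B \<in> components (- (\<Union>\<alpha>\<in>roots W. root_hyperplane \<alpha>))"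

definition wall_root ::
    "('a::euclidean_space \<Rightarrow> 'a) set \<Rightarrow> 'a set \<Rightarrow> 'a \<Rightarrow> bool" where
  "wall_root W B \<alpha> \<longleftrightarrow>
     \<alpha> \<in> roots W \<and> (root_hyperplane \<alpha> \<inter> closure B) facet_of (closure B)"

definition simple_reflections ::
    "('a::euclidean_space \<Rightarrow> 'a) set \<Rightarrow> 'a set \<Rightarrow> ('a \<Rightarrow> 'a) set" where
  "simple_reflections W B = reflection ` {\<alpha>. wall_root W B \<alpha>}"

definition reflection_rank ::
    "('a::euclidean_space \<Rightarrow> 'a) set \<Rightarrow> 'a set \<Rightarrow> nat" where
  "reflection_rank W B = card (simple_reflections W B)"

definition max_parabolic ::
    "('a::euclidean_space \<Rightarrow> 'a) set \<Rightarrow> 'a set \<Rightarrow> ('a \<Rightarrow> 'a) \<Rightarrow> ('a \<Rightarrow> 'a) set" where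
  "max_parabolic W B s = group_generated (simple_reflections W B - {s})"

definition persistent_simplex ::
    "('a::euclidean_space \<Rightarrow> 'a) set \<Rightarrow> 'a set \<Rightarrow> ('a \<Rightarrow> 'a) set \<Rightarrow> bool" where
  "persistent_simplex W B \<S> \<longleftrightarrow>
     \<S> \<subseteq> W \<and> card \<S> = reflection_rank W B + 1 \<and>
     (\<forall>a\<in>B. int (reflection_rank W B) simplex (convex hull ((\<lambda>w. w a) ` \<S>)))"

definition PersistS :: "('a::euclidean_space \<Rightarrow> 'a) set \<Rightarrow> 'a set \<Rightarrow> nat" where
  "PersistS W B = card {\<S>. persistent_simplex W B \<S>}"

end

theory Submission
  imports Defs
begin

text \<open>
  For \<open>a\<close> in the open chamber, the polytope spanned by the orbit of \<open>a\<close> has, for every simple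
  reflection \<open>s\<close> and every left coset \<open>w W\<^sub>s\<close>, a facet with vertex set \<open>w W\<^sub>s a\<close>. A persistent
  simplex of \<open>W\<^sub>s\<close>, translated by \<open>w\<close>, is a simplex of full dimension \<open>d - 1\<close> inside that facet,
  and any \<open>u\<close> outside the coset gives a point off the facet's hyperplane, whatever \<open>a\<close> is. So the
  translated simplex together with \<open>u\<close> is a persistent simplex of \<open>W\<close>, a pyramid with apex \<open>u\<close>
  (\<open>pyramid_persistent\<close>). The sum in the theorem counts these pyramids with their base and apex.
  A simplex has \<open>d + 1\<close> vertices that can serve as the apex; once the apex is chosen the base is
  known, and the base determines the facet (\<open>base_determines_coset\<close>). Hence no persistent simplex
  is counted more than \<open>d + 1\<close> times (\<open>pyramid_count\<close>).

  The facets are described by linear functionals: with \<open>\<omega>\<close> the fundamental weight of \<open>s\<close>, the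
  elements \<open>u\<close> of \<open>w W\<^sub>s\<close> are those with \<open>w \<omega> \<bullet> u a = \<omega> \<bullet> a\<close> (\<open>facet_functional\<close>). This rests
  on the classical facts that the closed chamber is a fundamental domain and that the stabilizer
  of each of its points is generated by the simple reflections fixing that point
  (\<open>closed_chamber_stabilizer\<close>), which are derived from the exchange condition.

  Persistence in \<open>W\<^sub>s\<close> is measured with an arbitrary chamber of \<open>W\<^sub>s\<close> and with the rank of \<open>W\<^sub>s\<close>.
  An element of \<open>W\<^sub>s\<close> carries the chamber of \<open>W\<close> into the given one
  (\<open>chamber_into_parabolic_chamber\<close>), and the rank is the dimension of the span of the roots, because
  the simple roots are linearly independent; for \<open>W\<^sub>s\<close> it is \<open>d - 1\<close> (\<open>parabolic_rank\<close>).
\<close>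

section \<open>Simplices spanned by few points\<close>

text \<open>
  The vertices of a simplex are hidden in its definition. For at most \<open>n + 1\<close> points, however,
  dimension \<open>n\<close> already forces affine independence, and dimensions are easier to compare.
\<close>

lemma simplex_convex_hull_iff:
  fixes X :: "'a::euclidean_space set"
  assumes "finite X" "card X \<le> n + 1"
  shows "int n simplex (convex hull X) \<longleftrightarrow> aff_dim X = int n"
proof
  assume "int n simplex (convex hull X)"
  then show "aff_dim X = int n" using aff_dim_simplex aff_dim_convex_hull by metis
next
  assume dim: "aff_dim X = int n"
  then have "card X = n + 1" using aff_dim_le_card[OF assms(1)] assms(2) by linarith
  then show "int n simplex (convex hull X)"
    using dim assms(1) by (intro simplex_convex_hull) (simp add: affine_independent_iff_card)
qed

section \<open>Groups generated by reflections\<close>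

lemma inner_reflection:
  "reflection \<alpha> x \<bullet> y = x \<bullet> y - 2 * (x \<bullet> \<alpha>) * (\<alpha> \<bullet> y) / (\<alpha> \<bullet> \<alpha>)"
  by (simp add: reflection_def inner_diff_left)

lemma reflection_unit:
  "norm \<alpha> = 1 \<Longrightarrow> reflection \<alpha> x = x - (2 * (x \<bullet> \<alpha>)) *\<^sub>R \<alpha>"
  by (simp add: reflection_def norm_eq_1)

lemma orthogonal_transformation_reflection: "orthogonal_transformation (reflection \<alpha>)"
proof -
  have "linear (reflection \<alpha>)"
    by (rule linearI) (simp_all add: reflection_def inner_add_left algebra_simps add_divide_distrib)
  moreover have "reflection \<alpha> v \<bullet> reflection \<alpha> w = v \<bullet> w" for v w
    by (cases "\<alpha> = 0")
      (simp_all add: reflection_def inner_diff_left inner_diff_right inner_commute field_simps)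
  ultimately show ?thesis by (simp add: orthogonal_transformation_def)
qed

lemma reflection_involution [simp]: "reflection \<alpha> (reflection \<alpha> x) = x"
  by (cases "\<alpha> = 0") (simp_all add: reflection_def inner_diff_left field_simps)

lemma reflection_comp_self [simp]: "reflection \<alpha> \<circ> reflection \<alpha> = id"
  by (simp add: fun_eq_iff)

lemma reflection_self [simp]: "reflection \<alpha> \<alpha> = - \<alpha>"
  by (cases "\<alpha> = 0") (simp_all add: reflection_def scaleR_2)

lemma reflection_fix: "x \<bullet> \<alpha> = 0 \<Longrightarrow> reflection \<alpha> x = x"
  by (simp add: reflection_def)

lemma reflection_minus [simp]: "reflection (- \<alpha>) = reflection \<alpha>"
  by (simp add: reflection_def fun_eq_iff)

lemma reflection_normalize: "reflection (\<alpha> /\<^sub>R norm \<alpha>) = reflection \<alpha>"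
proof (cases "\<alpha> = 0")
  case False
  have "(\<alpha> /\<^sub>R norm \<alpha>) \<bullet> (\<alpha> /\<^sub>R norm \<alpha>) = 1"
    using False by (metis norm_eq_1 norm_sgn sgn_div_norm)
  then show ?thesis
    using False
    by (simp add: reflection_def fun_eq_iff dot_square_norm power2_eq_square field_simps)
qed simp

lemma reflection_conj:
  assumes "orthogonal_transformation g"
  shows "g \<circ> reflection \<alpha> = reflection (g \<alpha>) \<circ> g"
proof -
  have "linear g" and "\<And>x y. g x \<bullet> g y = x \<bullet> y"
    using assms by (auto simp: orthogonal_transformation_def)
  then show ?thesis
    by (simp add: reflection_def fun_eq_iff linear_diff linear_scale)
qed

lemma reflection_eq_unit:
  assumes "norm \<alpha> = 1" "norm \<beta> = 1" "reflection \<alpha> = reflection \<beta>"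
  shows "\<alpha> = \<beta> \<or> \<alpha> = - \<beta>"
proof -
  have "- \<alpha> = \<alpha> - (2 * (\<alpha> \<bullet> \<beta>)) *\<^sub>R \<beta>"
    using reflection_self[of \<alpha>] reflection_unit[OF assms(2), of \<alpha>] assms(3) by simp
  then have "2 *\<^sub>R \<alpha> = 2 *\<^sub>R ((\<alpha> \<bullet> \<beta>) *\<^sub>R \<beta>)"
    by (simp add: algebra_simps scaleR_2)
  then have *: "\<alpha> = (\<alpha> \<bullet> \<beta>) *\<^sub>R \<beta>" by (simp only: scaleR_cancel_left) simp
  then have "\<bar>\<alpha> \<bullet> \<beta>\<bar> = 1" using assms by (metis norm_scaleR mult.right_neutral)
  with * show ?thesis by (metis abs_eq_iff abs_1 scaleR_one scaleR_minus1_left)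
qed

text \<open>
  A reflection is its own inverse, so the generated group consists of the plain products of
  generators; listing the roots of the factors makes induction on the word available.
\<close>

definition refl_word :: "'a::euclidean_space list \<Rightarrow> 'a \<Rightarrow> 'a" where
  "refl_word xs = foldr (\<lambda>\<alpha> f. reflection \<alpha> \<circ> f) xs id"

lemma refl_word_Nil [simp]: "refl_word [] = id"
  and refl_word_Cons [simp]: "refl_word (\<alpha> # xs) = reflection \<alpha> \<circ> refl_word xs"
  by (simp_all add: refl_word_def)

lemma refl_word_append: "refl_word (xs @ ys) = refl_word xs \<circ> refl_word ys"
  by (induction xs) (simp_all add: comp_assoc)

lemma refl_word_rev: "refl_word (rev xs) \<circ> refl_word xs = id"
  by (induction xs) (simp_all add: refl_word_append fun_eq_iff)

lemma refl_word_rev': "refl_word xs \<circ> refl_word (rev xs) = id"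
  using refl_word_rev[of "rev xs"] by simp

lemma orthogonal_transformation_refl_word: "orthogonal_transformation (refl_word xs)"
proof (induction xs)
  case Nil
  show ?case using orthogonal_transformation_id by (simp add: id_def)
next
  case (Cons \<alpha> xs)
  then show ?case
    unfolding refl_word_Cons
    by (intro orthogonal_transformation_compose orthogonal_transformation_reflection)
qed

lemma BijGroup_UNIV:
  "carrier (BijGroup UNIV) = {f. bij f}"
  "bij f \<Longrightarrow> bij g \<Longrightarrow> f \<otimes>\<^bsub>BijGroup UNIV\<^esub> g = f \<circ> g"
  "\<one>\<^bsub>BijGroup UNIV\<^esub> = id"
  by (auto simp: BijGroup_def Bij_def compose_def fun_eq_iff)

lemma group_generated_reflections:
  "group_generated (reflection ` A) = refl_word ` lists (A :: 'a::euclidean_space set)"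
proof
  let ?G = "BijGroup (UNIV :: 'a set)"
  have bw: "bij (refl_word xs)" for xs :: "'a list"
    by (rule orthogonal_transformation_bij[OF orthogonal_transformation_refl_word])
  have br: "bij (reflection \<alpha>)" for \<alpha> :: 'a
    by (rule orthogonal_transformation_bij[OF orthogonal_transformation_reflection])
  show "group_generated (reflection ` A) \<subseteq> refl_word ` lists A"
  proof
    fix g assume "g \<in> group_generated (reflection ` A)"
    then have "g \<in> generate ?G (reflection ` A)" by (simp add: group_generated_def)
    then show "g \<in> refl_word ` lists A"
    proof induction
      case one
      show ?case by (intro image_eqI[of _ _ "[]"]) (auto simp: BijGroup_UNIV)
    next
      case (incl h)
      then obtain \<alpha> where "\<alpha> \<in> A" "h = reflection \<alpha>" by auto
      then show ?case by (intro image_eqI[of _ _ "[\<alpha>]"]) auto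
    next
      case (inv h)
      then obtain \<alpha> where \<alpha>: "\<alpha> \<in> A" "h = reflection \<alpha>" by auto
      have "inv\<^bsub>?G\<^esub> h = h"
        by (rule group.inv_equality[OF group_BijGroup])
          (use \<alpha> br[of \<alpha>] in \<open>simp_all add: BijGroup_UNIV\<close>)
      with \<alpha> show ?case by (intro image_eqI[of _ _ "[\<alpha>]"]) auto
    next
      case (eng h1 h2)
      then obtain xs ys where "xs \<in> lists A" "ys \<in> lists A" "h1 = refl_word xs" "h2 = refl_word ys"
        by auto
      then show ?case
        by (intro image_eqI[of _ _ "xs @ ys"]) (auto simp: BijGroup_UNIV bw refl_word_append)
    qed
  qed
  show "refl_word ` lists A \<subseteq> group_generated (reflection ` A)"
  proof (rule image_subsetI)
    fix xs assume "xs \<in> lists A"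
    then have "refl_word xs \<in> generate ?G (reflection ` A)"
    proof (induction xs)
      case Nil
      show ?case using generate.one[of ?G "reflection ` A"]
        by (simp only: BijGroup_UNIV refl_word_Nil)
    next
      case (Cons \<alpha> xs)
      then have "reflection \<alpha> \<in> generate ?G (reflection ` A)"
        and "refl_word xs \<in> generate ?G (reflection ` A)"
        by (auto intro: generate.incl)
      then have "reflection \<alpha> \<otimes>\<^bsub>?G\<^esub> refl_word xs \<in> generate ?G (reflection ` A)"
        by (rule generate.eng)
      then show ?case by (simp only: BijGroup_UNIV(2)[OF br bw] refl_word_Cons)
    qed
    then show "refl_word xs \<in> group_generated (reflection ` A)"
      by (simp add: group_generated_def)
  qed
qed

lemma id_in_refl_words: "id \<in> refl_word ` lists A"
  by (rule image_eqI[of _ _ "[]"]) auto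

lemma comp_in_refl_words:
  assumes "g \<in> refl_word ` lists A" "h \<in> refl_word ` lists A"
  shows "g \<circ> h \<in> refl_word ` lists A"
proof -
  obtain xs ys where "xs \<in> lists A" "ys \<in> lists A" "g = refl_word xs" "h = refl_word ys"
    using assms by auto
  then show ?thesis by (intro image_eqI[of _ _ "xs @ ys"]) (auto simp: refl_word_append)
qed

lemma inverse_in_refl_words:
  assumes "g \<in> refl_word ` lists A"
  obtains h where "h \<in> refl_word ` lists A" "h \<circ> g = id" "g \<circ> h = id"
proof -
  obtain xs where xs: "xs \<in> lists A" "g = refl_word xs" using assms by auto
  then have "refl_word (rev xs) \<in> refl_word ` lists A" by (intro imageI) auto
  then show ?thesis using that xs refl_word_rev refl_word_rev' by blast
qed

lemma refl_word_fix:
  assumes "\<And>\<alpha>. \<alpha> \<in> set xs \<Longrightarrow> x \<bullet> \<alpha> = 0"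
  shows "refl_word xs x = x"
  using assms by (induction xs) (simp_all add: reflection_fix)

lemma refl_word_diff_in_span:
  assumes "set xs \<subseteq> D"
  shows "refl_word xs x - x \<in> span D"
  using assms
proof (induction xs)
  case Nil
  show ?case by (simp add: span_0)
next
  case (Cons \<alpha> xs)
  let ?y = "refl_word xs x"
  have "reflection \<alpha> ?y - ?y \<in> span D"
    using Cons.prems by (simp add: reflection_def span_neg span_scale span_base)
  then have "(reflection \<alpha> ?y - ?y) + (?y - x) \<in> span D"
    using Cons by (intro span_add) auto
  then show ?case by simp
qed

text \<open>
  The word moves every point by a vector in the span of \<open>D\<close>, and a reflection moves its root
  \<open>\<beta>\<close> by \<open>- 2 \<beta>\<close>.
\<close>

lemma root_in_span:
  assumes "reflection \<beta> \<in> refl_word ` lists D"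
  shows "\<beta> \<in> span D"
proof -
  obtain xs where "xs \<in> lists D" "reflection \<beta> = refl_word xs" using assms by auto
  then have "reflection \<beta> \<beta> - \<beta> \<in> span D" using refl_word_diff_in_span[of xs D \<beta>] by auto
  then have "(- 1 / 2) *\<^sub>R (reflection \<beta> \<beta> - \<beta>) \<in> span D" by (rule span_scale)
  then show ?thesis by (simp add: algebra_simps flip: scaleR_add_left)
qed

section \<open>Chambers and their walls\<close>

text \<open>
  The base point orients the walls: of the two unit normals of a hyperplane, the positive one
  points to the side of \<open>b\<close>, hence of all of \<open>B\<close>.
\<close>

locale reflection_chamber =
  fixes W :: "('a::euclidean_space \<Rightarrow> 'a) set" and B :: "'a set" and b :: 'a
  assumes reflection_group: "finite_reflection_group W"
    and chamber: "chamber W B"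
    and base_point: "b \<in> B"
begin

definition pos_roots :: "'a set" where
  "pos_roots = {\<alpha> \<in> roots W. 0 < \<alpha> \<bullet> b}"

definition simple_roots :: "'a set" where
  "simple_roots = {\<alpha>. wall_root W B \<alpha> \<and> 0 < \<alpha> \<bullet> b}"

subsection \<open>The group and its roots\<close>

lemma finite_group: "finite W"
  using reflection_group by (simp add: finite_reflection_group_def)

lemma group_words: "\<exists>A. W = refl_word ` lists A"
  using reflection_group unfolding finite_reflection_group_def group_generated_reflections by auto

lemma id_in_group: "id \<in> W"
  and comp_in_group: "g \<in> W \<Longrightarrow> h \<in> W \<Longrightarrow> g \<circ> h \<in> W"
  using group_words id_in_refl_words comp_in_refl_words by metis+

lemma inverse_in_group:
  assumes "g \<in> W"
  obtains h where "h \<in> W" "h \<circ> g = id" "g \<circ> h = id"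
proof -
  obtain A where A: "W = refl_word ` lists A" using group_words by blast
  show ?thesis using inverse_in_refl_words[of g A] assms that unfolding A[symmetric] by blast
qed

lemma orthogonal_in_group: "g \<in> W \<Longrightarrow> orthogonal_transformation g"
proof -
  assume "g \<in> W"
  obtain A where "W = refl_word ` lists A" using group_words by blast
  with \<open>g \<in> W\<close> show ?thesis using orthogonal_transformation_refl_word by auto
qed

lemma inner_in_group: "g \<in> W \<Longrightarrow> g x \<bullet> g y = x \<bullet> y"
  and linear_in_group: "g \<in> W \<Longrightarrow> linear g"
  and bij_in_group: "g \<in> W \<Longrightarrow> bij g"
  using orthogonal_in_group[of g] orthogonal_transformation_bij[of g]
  by (auto simp: orthogonal_transformation_def)

lemma inner_in_group_adjoint:
  assumes g: "g \<in> W" and h: "h \<circ> g = id"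
  shows "x \<bullet> g y = h x \<bullet> y"
proof -
  obtain z where "x = g z" using bij_in_group[OF g] by (metis bij_pointE)
  moreover have "h (g z) = z" using h by (simp add: fun_eq_iff)
  ultimately show ?thesis using inner_in_group[OF g] by simp
qed

lemma norm_root: "\<alpha> \<in> roots W \<Longrightarrow> norm \<alpha> = 1"
  and reflection_root: "\<alpha> \<in> roots W \<Longrightarrow> reflection \<alpha> \<in> W"
  and inner_root_self: "\<alpha> \<in> roots W \<Longrightarrow> \<alpha> \<bullet> \<alpha> = 1"
  and minus_root: "\<alpha> \<in> roots W \<Longrightarrow> - \<alpha> \<in> roots W"
  by (auto simp: roots_def norm_eq_1)

lemma group_root:
  assumes g: "g \<in> W" and \<alpha>: "\<alpha> \<in> roots W"
  shows "g \<alpha> \<in> roots W"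
proof -
  obtain h where h: "h \<in> W" "g \<circ> h = id" using inverse_in_group[OF g] by blast
  have "reflection (g \<alpha>) x = (g \<circ> reflection \<alpha> \<circ> h) x" for x
    using fun_cong[OF reflection_conj[OF orthogonal_in_group[OF g], of \<alpha>], of "h x"]
      fun_cong[OF h(2), of x] by simp
  then have "reflection (g \<alpha>) = g \<circ> reflection \<alpha> \<circ> h" by (rule ext)
  moreover have "norm (g \<alpha>) = 1"
    using orthogonal_transformation_norm[OF orthogonal_in_group[OF g]] norm_root[OF \<alpha>] by simp
  ultimately show ?thesis
    using comp_in_group[OF comp_in_group[OF g reflection_root[OF \<alpha>]] h(1)]
    by (simp add: roots_def)
qed

lemma finite_roots: "finite (roots W)"
proof -
  have "finite {\<alpha>. norm \<alpha> = 1 \<and> reflection \<alpha> = w}" for w :: "'a \<Rightarrow> 'a"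
  proof (cases "\<exists>\<beta>. norm \<beta> = 1 \<and> reflection \<beta> = w")
    case True
    then obtain \<beta> where \<beta>: "norm \<beta> = 1" "reflection \<beta> = w" by blast
    have "\<alpha> \<in> {\<beta>, - \<beta>}" if "norm \<alpha> = 1 \<and> reflection \<alpha> = w" for \<alpha>
      using reflection_eq_unit[of \<alpha> \<beta>] that \<beta> by simp
    then have "{\<alpha>. norm \<alpha> = 1 \<and> reflection \<alpha> = w} \<subseteq> {\<beta>, - \<beta>}" by blast
    then show ?thesis by (rule finite_subset) simp
  next
    case False
    then have "{\<alpha>. norm \<alpha> = 1 \<and> reflection \<alpha> = w} = {}" by blast
    then show ?thesis by (simp only: finite.emptyI)
  qed
  then have "finite (\<Union>w\<in>W. {\<alpha>. norm \<alpha> = 1 \<and> reflection \<alpha> = w})"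
    using finite_group by blast
  then show ?thesis by (rule rev_finite_subset) (auto simp: roots_def)
qed

lemma roots_generate: "W = refl_word ` lists (roots W)"
proof
  obtain A where A: "0 \<notin> A" "W = refl_word ` lists A"
    using reflection_group unfolding finite_reflection_group_def group_generated_reflections by auto
  have "reflection \<alpha> \<in> W" if "\<alpha> \<in> A" for \<alpha>
    unfolding A(2) using that by (intro image_eqI[of _ _ "[\<alpha>]"]) auto
  then have root: "\<alpha> /\<^sub>R norm \<alpha> \<in> roots W" if "\<alpha> \<in> A" for \<alpha>
    using that A(1) norm_sgn[of \<alpha>] by (auto simp: roots_def reflection_normalize sgn_div_norm)
  have "refl_word xs \<in> refl_word ` lists (roots W)" if "xs \<in> lists A" for xs
  proof
    show "refl_word xs = refl_word (map (\<lambda>\<alpha>. \<alpha> /\<^sub>R norm \<alpha>) xs)"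
      by (induction xs) (simp_all add: reflection_normalize)
    show "map (\<lambda>\<alpha>. \<alpha> /\<^sub>R norm \<alpha>) xs \<in> lists (roots W)" using that root by auto
  qed
  then show "W \<subseteq> refl_word ` lists (roots W)" using A(2) by blast
  show "refl_word ` lists (roots W) \<subseteq> W"
  proof (rule image_subsetI)
    fix xs assume "xs \<in> lists (roots W)"
    then show "refl_word xs \<in> W"
    proof (induction xs)
      case Nil
      show ?case unfolding refl_word_Nil by (rule id_in_group)
    next
      case (Cons \<alpha> xs)
      then show ?case unfolding refl_word_Cons by (intro comp_in_group reflection_root) auto
    qed
  qed
qed

subsection \<open>The chamber as an intersection of half-spaces\<close>

lemma root_regular: "\<alpha> \<in> roots W \<Longrightarrow> x \<in> B \<Longrightarrow> \<alpha> \<bullet> x \<noteq> 0"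
  using in_components_subset[OF chamber[unfolded chamber_def]]
  by (auto simp: root_hyperplane_def)

lemma root_pos_or_neg: "\<alpha> \<in> roots W \<Longrightarrow> \<alpha> \<in> pos_roots \<or> - \<alpha> \<in> pos_roots"
  using root_regular[OF _ base_point] minus_root by (force simp: pos_roots_def)

lemma pos_root_is_root: "\<alpha> \<in> pos_roots \<Longrightarrow> \<alpha> \<in> roots W"
  by (simp add: pos_roots_def)

text \<open>
  No root changes sign on the connected set \<open>B\<close>, and the intersection of the positive open
  half-spaces is itself connected and avoids the hyperplanes.
\<close>

lemma chamber_eq: "B = {x. \<forall>\<alpha>\<in>pos_roots. 0 < \<alpha> \<bullet> x}"
proof
  have "connected B" by (rule in_components_connected[OF chamber[unfolded chamber_def]])
  show "B \<subseteq> {x. \<forall>\<alpha>\<in>pos_roots. 0 < \<alpha> \<bullet> x}"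
  proof (clarify, rule ccontr)
    fix x \<alpha> assume x: "x \<in> B" and \<alpha>: "\<alpha> \<in> pos_roots" and neg: "\<not> 0 < \<alpha> \<bullet> x"
    have "connected ((\<lambda>y. \<alpha> \<bullet> y) ` B)"
      by (intro connected_continuous_image \<open>connected B\<close> continuous_intros)
    then have "0 \<in> (\<lambda>y. \<alpha> \<bullet> y) ` B"
      using x base_point \<alpha> neg by (auto simp: pos_roots_def connected_iff_interval)
    then show False using root_regular \<alpha> pos_root_is_root by fastforce
  qed
  let ?P = "{x. \<forall>\<alpha>\<in>pos_roots. 0 < \<alpha> \<bullet> x}"
  have "?P = (\<Inter>\<alpha>\<in>pos_roots. {x. 0 < \<alpha> \<bullet> x})" by auto
  then have "convex ?P" by (auto intro: convex_INT convex_halfspace_gt)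
  moreover have "?P \<subseteq> - (\<Union>\<alpha>\<in>roots W. root_hyperplane \<alpha>)"
    using root_pos_or_neg by (fastforce simp: root_hyperplane_def)
  moreover have "b \<in> B \<inter> ?P" using base_point by (auto simp: pos_roots_def)
  ultimately show "?P \<subseteq> B"
    by (intro components_maximal[OF chamber[unfolded chamber_def]] convex_connected) auto
qed

lemma in_chamber_iff: "x \<in> B \<longleftrightarrow> (\<forall>\<alpha>\<in>pos_roots. 0 < \<alpha> \<bullet> x)"
  using chamber_eq by blast

lemma finite_pos_roots: "finite pos_roots"
  using finite_roots by (simp add: pos_roots_def)

lemma open_chamber: "open B"
proof -
  have "B = (\<Inter>\<alpha>\<in>pos_roots. {x. 0 < \<alpha> \<bullet> x})" unfolding chamber_eq by auto
  then show ?thesis using finite_pos_roots open_halfspace_gt by auto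
qed

lemma closure_chamber_eq: "closure B = {x. \<forall>\<alpha>\<in>pos_roots. 0 \<le> \<alpha> \<bullet> x}" (is "_ = ?P")
proof
  have "?P = (\<Inter>\<alpha>\<in>pos_roots. {x. 0 \<le> \<alpha> \<bullet> x})" by auto
  then have "closed ?P" by (auto intro: closed_INT closed_halfspace_ge)
  moreover have "B \<subseteq> ?P" unfolding chamber_eq by (auto intro: less_imp_le)
  ultimately show "closure B \<subseteq> ?P" by (simp add: closure_minimal)
  show "?P \<subseteq> closure B"
  proof
    fix x assume x: "x \<in> ?P"
    \<comment> \<open>A small step towards \<open>b\<close> makes all the inequalities strict.\<close>
    have "(\<lambda>n. x + inverse (real (Suc n)) *\<^sub>R b) \<longlonglongrightarrow> x + 0 *\<^sub>R b"
      by (intro tendsto_intros LIMSEQ_inverse_real_of_nat)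
    moreover have "x + inverse (real (Suc n)) *\<^sub>R b \<in> B" for n
      using x base_point by (auto simp: in_chamber_iff inner_add_right intro!: add_nonneg_pos)
    ultimately show "x \<in> closure B"
      unfolding closure_sequential by (auto intro!: exI[of _ "\<lambda>n. x + inverse (real (Suc n)) *\<^sub>R b"])
  qed
qed

lemma in_closure_chamber_iff: "x \<in> closure B \<longleftrightarrow> (\<forall>\<alpha>\<in>pos_roots. 0 \<le> \<alpha> \<bullet> x)"
  using closure_chamber_eq by blast

lemma regular_in_closure_chamber:
  assumes "x \<in> closure B" "\<And>\<alpha>. \<alpha> \<in> roots W \<Longrightarrow> \<alpha> \<bullet> x \<noteq> 0"
  shows "x \<in> B"
  using assms pos_root_is_root
  by (auto simp: in_chamber_iff in_closure_chamber_iff order_less_le)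

lemma aff_dim_closure_chamber: "aff_dim (closure B) = DIM('a)"
  using aff_dim_open[OF open_chamber] base_point
  by (metis aff_dim_affine_hull closure_affine_hull closure_subset aff_dim_subset aff_dim_le_DIM
      empty_iff order_antisym)

lemma simple_roots_pos: "simple_roots \<subseteq> pos_roots"
  by (auto simp: simple_roots_def pos_roots_def wall_root_def)

text \<open>
  A minimal system of half-spaces cutting out the closed chamber has all its boundary hyperplanes
  as walls, so the walls alone already cut it out.
\<close>

lemma closure_chamber_simple: "closure B = {x. \<forall>\<alpha>\<in>simple_roots. 0 \<le> \<alpha> \<bullet> x}"
proof
  show "closure B \<subseteq> {x. \<forall>\<alpha>\<in>simple_roots. 0 \<le> \<alpha> \<bullet> x}"
    using simple_roots_pos unfolding closure_chamber_eq by auto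
  let ?h = "\<lambda>\<alpha>::'a. {x. (- \<alpha>) \<bullet> x \<le> 0}"
  let ?ok = "\<lambda>F. F \<subseteq> ?h ` pos_roots \<and> closure B = \<Inter>F"
  have "?ok (?h ` pos_roots)" unfolding closure_chamber_eq by auto
  then have "\<exists>F. ?ok F \<and> (\<forall>F'. ?ok F' \<longrightarrow> card F \<le> card F')" by (rule ex_has_least_nat)
  then obtain F where F_least: "?ok F \<and> (\<forall>F'. ?ok F' \<longrightarrow> card F \<le> card F')" ..
  note F = conjunct1[OF F_least] and least = conjunct2[OF F_least]
  have fin: "finite F" using F finite_pos_roots finite_subset by blast
  define a where "a = (\<lambda>h. inv_into pos_roots ?h h)"
  have a: "a h \<in> pos_roots" "?h (a h) = h" if "h \<in> F" for h
  proof -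
    have h: "h \<in> ?h ` pos_roots" using F that by blast
    show "a h \<in> pos_roots" unfolding a_def by (rule inv_into_into[OF h])
    show "?h (a h) = h" unfolding a_def by (rule f_inv_into_f[OF h])
  qed
  have hull: "affine hull (closure B) = UNIV"
    using aff_dim_closure_chamber by (simp add: aff_dim_eq_full)
  have minimal: "closure B \<subset> affine hull (closure B) \<inter> \<Inter>F'" if "F' \<subset> F" for F'
  proof -
    have "\<not> ?ok F'" using spec[OF least, of F'] psubset_card_mono[OF fin that] by linarith
    then have "closure B \<noteq> \<Inter>F'" using F that by blast
    moreover have "closure B \<subseteq> \<Inter>F'" using F that by blast
    ultimately show ?thesis unfolding hull by blast
  qed
  have facet: "C facet_of closure B \<longleftrightarrow> (\<exists>h. h \<in> F \<and> C = closure B \<inter> {x. - a h \<bullet> x = 0})" for C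
  proof (rule facet_of_polyhedron_explicit[OF fin _ _ minimal])
    show "closure B = affine hull (closure B) \<inter> \<Inter>F" using F unfolding hull by blast
    show "- a h \<noteq> 0 \<and> h = {x. - a h \<bullet> x \<le> 0}" if "h \<in> F" for h
      using a[OF that] by (auto simp: pos_roots_def)
  qed
  have "a h \<in> simple_roots" if "h \<in> F" for h
  proof -
    have "root_hyperplane (a h) \<inter> closure B = closure B \<inter> {x. - a h \<bullet> x = 0}"
      by (auto simp: root_hyperplane_def)
    then show ?thesis
      using facet a[OF that] that
      by (auto simp: simple_roots_def wall_root_def pos_roots_def)
  qed
  then show "{x. \<forall>\<alpha>\<in>simple_roots. 0 \<le> \<alpha> \<bullet> x} \<subseteq> closure B"
    using F a(2) by fastforce
qed

lemma in_closure_chamber_simple_iff: "x \<in> closure B \<longleftrightarrow> (\<forall>\<alpha>\<in>simple_roots. 0 \<le> \<alpha> \<bullet> x)"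
  using closure_chamber_simple by blast

lemma simple_root_is_root: "\<alpha> \<in> simple_roots \<Longrightarrow> \<alpha> \<in> roots W"
  using simple_roots_pos pos_root_is_root by blast

lemma simple_root_base: "\<alpha> \<in> simple_roots \<Longrightarrow> 0 < \<alpha> \<bullet> b"
  by (simp add: simple_roots_def)

lemma finite_simple_roots: "finite simple_roots"
  using simple_roots_pos finite_pos_roots finite_subset by blast

lemma inj_on_reflection_simple: "inj_on reflection simple_roots"
proof (rule inj_onI)
  fix \<alpha> \<beta> assume *: "\<alpha> \<in> simple_roots" "\<beta> \<in> simple_roots" "reflection \<alpha> = reflection \<beta>"
  then have "\<alpha> = \<beta> \<or> \<alpha> = - \<beta>"
    by (intro reflection_eq_unit) (auto intro: norm_root simple_root_is_root)
  then show "\<alpha> = \<beta>" using * simple_root_base[of \<alpha>] simple_root_base[of \<beta>] by auto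
qed

lemma simple_reflections_eq: "simple_reflections W B = reflection ` simple_roots"
proof
  have "reflection \<alpha> \<in> reflection ` simple_roots" if "wall_root W B \<alpha>" for \<alpha>
  proof (cases "0 < \<alpha> \<bullet> b")
    case False
    have "wall_root W B (- \<alpha>)"
      using that minus_root[of \<alpha>] by (simp add: wall_root_def root_hyperplane_def)
    moreover have "0 < (- \<alpha>) \<bullet> b"
      using False root_regular[OF _ base_point, of \<alpha>] that by (simp add: wall_root_def)
    ultimately have "- \<alpha> \<in> simple_roots" by (simp add: simple_roots_def)
    then show ?thesis by (intro image_eqI[of _ _ "- \<alpha>"]) simp_all
  qed (use that in \<open>simp add: simple_roots_def\<close>)
  then show "simple_reflections W B \<subseteq> reflection ` simple_roots"
    by (auto simp: simple_reflections_def)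
  show "reflection ` simple_roots \<subseteq> simple_reflections W B"
    by (auto simp: simple_reflections_def simple_roots_def)
qed

lemma reflection_rank_eq: "reflection_rank W B = card simple_roots"
  by (simp add: reflection_rank_def simple_reflections_eq card_image inj_on_reflection_simple)

text \<open>
  A facet spans its hyperplane, so a root vanishing on it has that hyperplane as its own.
\<close>

lemma root_vanishing_on_wall:
  assumes \<alpha>: "\<alpha> \<in> simple_roots" and \<beta>: "\<beta> \<in> pos_roots"
    and vanish: "\<And>x. x \<in> closure B \<Longrightarrow> \<alpha> \<bullet> x = 0 \<Longrightarrow> \<beta> \<bullet> x = 0"
  shows "\<beta> = \<alpha>"
proof -
  let ?F = "root_hyperplane \<alpha> \<inter> closure B"
  have unit: "\<alpha> \<bullet> \<alpha> = 1" "\<beta> \<bullet> \<beta> = 1"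
    using \<alpha> \<beta> by (auto simp: inner_root_self simple_root_is_root pos_root_is_root)
  then have "\<alpha> \<noteq> 0" by auto
  have "aff_dim ?F = DIM('a) - 1"
    using \<alpha> aff_dim_closure_chamber by (simp add: simple_roots_def wall_root_def facet_of_def)
  moreover have "0 \<in> ?F" by (simp add: in_closure_chamber_iff root_hyperplane_def)
  ultimately have "int (dim ?F) = DIM('a) - 1" by (metis aff_dim_zero hull_inc)
  then have "dim (span ?F) = dim {x. \<alpha> \<bullet> x = 0}"
    using \<open>\<alpha> \<noteq> 0\<close> by (simp add: dim_hyperplane)
  moreover have "span ?F \<subseteq> {x. \<alpha> \<bullet> x = 0}"
    by (intro span_minimal subspace_hyperplane) (auto simp: root_hyperplane_def)
  ultimately have "span ?F = {x. \<alpha> \<bullet> x = 0}"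
    by (intro subspace_dim_equal subspace_span subspace_hyperplane) auto
  moreover have "span ?F \<subseteq> {x. \<beta> \<bullet> x = 0}"
    using vanish by (intro span_minimal subspace_hyperplane) (auto simp: root_hyperplane_def)
  moreover have "\<beta> - (\<alpha> \<bullet> \<beta>) *\<^sub>R \<alpha> \<in> {x. \<alpha> \<bullet> x = 0}"
    by (simp add: inner_diff_right unit)
  ultimately have "\<beta> \<bullet> (\<beta> - (\<alpha> \<bullet> \<beta>) *\<^sub>R \<alpha>) = 0" by blast
  \<comment> \<open>This is the equality case of the Cauchy-Schwarz inequality for the unit vectors \<open>\<alpha>, \<beta>\<close>.\<close>
  then have c: "(\<alpha> \<bullet> \<beta>)\<^sup>2 = 1" by (simp add: inner_diff_right unit power2_eq_square inner_commute)
  have "(\<beta> - (\<alpha> \<bullet> \<beta>) *\<^sub>R \<alpha>) \<bullet> (\<beta> - (\<alpha> \<bullet> \<beta>) *\<^sub>R \<alpha>) = 0"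
    using c by (simp add: inner_diff_right inner_diff_left unit power2_eq_square inner_commute)
  then have eq: "\<beta> = (\<alpha> \<bullet> \<beta>) *\<^sub>R \<alpha>" by simp
  have "0 < (\<alpha> \<bullet> \<beta>) * (\<alpha> \<bullet> b)"
    using \<beta> eq by (metis (no_types, lifting) inner_scaleR_left mem_Collect_eq pos_roots_def)
  then have "\<alpha> \<bullet> \<beta> = 1" using c simple_root_base[OF \<alpha>] by (auto simp: power2_eq_1_iff)
  with eq show ?thesis by simp
qed

subsection \<open>The simple roots generate the group and are linearly independent\<close>

text \<open>
  On the wall of \<open>\<alpha>\<close> the roots \<open>\<beta>\<close> and \<open>reflection \<alpha> \<beta>\<close> agree; if they had opposite signs, both
  would vanish there.
\<close>

lemma simple_reflection_pos:
  assumes \<alpha>: "\<alpha> \<in> simple_roots" and \<beta>: "\<beta> \<in> pos_roots" and "\<beta> \<noteq> \<alpha>"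
  shows "reflection \<alpha> \<beta> \<in> pos_roots"
proof (rule ccontr)
  let ?\<gamma> = "reflection \<alpha> \<beta>"
  assume "?\<gamma> \<notin> pos_roots"
  moreover have "?\<gamma> \<in> roots W"
    by (rule group_root[OF reflection_root[OF simple_root_is_root[OF \<alpha>]] pos_root_is_root[OF \<beta>]])
  ultimately have neg: "- ?\<gamma> \<in> pos_roots" using root_pos_or_neg by blast
  have "\<beta> = \<alpha>"
  proof (rule root_vanishing_on_wall[OF \<alpha> \<beta>])
    fix x assume x: "x \<in> closure B" "\<alpha> \<bullet> x = 0"
    have "0 \<le> \<beta> \<bullet> x" "0 \<le> - ?\<gamma> \<bullet> x" using x(1) neg \<beta> unfolding in_closure_chamber_iff by auto
    moreover have "?\<gamma> \<bullet> x = \<beta> \<bullet> x" using x(2) by (simp add: inner_reflection)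
    ultimately show "\<beta> \<bullet> x = 0" by simp
  qed
  with \<open>\<beta> \<noteq> \<alpha>\<close> show False by simp
qed

text \<open>
  If \<open>\<alpha> \<bullet> \<beta> > 0\<close>, then \<open>\<beta>\<close> is the sum of the positive root \<open>reflection \<alpha> \<beta>\<close> and a positive
  multiple of \<open>\<alpha>\<close>, so \<open>\<alpha>\<close> would vanish on the wall of \<open>\<beta>\<close>.
\<close>

lemma simple_roots_obtuse:
  assumes \<alpha>: "\<alpha> \<in> simple_roots" and \<beta>: "\<beta> \<in> simple_roots" and "\<alpha> \<noteq> \<beta>"
  shows "\<alpha> \<bullet> \<beta> \<le> 0"
proof (rule ccontr)
  assume "\<not> \<alpha> \<bullet> \<beta> \<le> 0"
  then have pos: "0 < \<beta> \<bullet> \<alpha>" by (simp add: inner_commute)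
  have \<gamma>: "reflection \<alpha> \<beta> \<in> pos_roots"
    using assms simple_roots_pos by (intro simple_reflection_pos) auto
  have "\<alpha> = \<beta>"
  proof (rule root_vanishing_on_wall[OF \<beta>])
    show "\<alpha> \<in> pos_roots" using \<alpha> simple_roots_pos by auto
    fix x assume x: "x \<in> closure B" "\<beta> \<bullet> x = 0"
    have "0 \<le> \<alpha> \<bullet> x" "0 \<le> reflection \<alpha> \<beta> \<bullet> x"
      using x(1) \<alpha> \<gamma> simple_roots_pos unfolding in_closure_chamber_iff by auto
    moreover have "reflection \<alpha> \<beta> \<bullet> x = - 2 * (\<beta> \<bullet> \<alpha>) * (\<alpha> \<bullet> x)"
      using x(2) inner_root_self[OF simple_root_is_root[OF \<alpha>]] by (simp add: inner_reflection)
    ultimately show "\<alpha> \<bullet> x = 0" using pos by (auto simp: mult_le_0_iff zero_le_mult_iff)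
  qed
  with \<open>\<alpha> \<noteq> \<beta>\<close> show False by simp
qed

text \<open>
  Vectors at pairwise obtuse angles in an open half-space: in a relation the positive and the
  negative part are equal to one vector \<open>v\<close> with \<open>v \<bullet> v \<le> 0\<close>, and pairing with \<open>b\<close> shows that
  every coefficient vanishes.
\<close>

lemma independent_simple_roots: "independent simple_roots"
proof -
  have "\<forall>\<alpha>\<in>simple_roots. c \<alpha> = 0" if rel: "(\<Sum>\<alpha>\<in>simple_roots. c \<alpha> *\<^sub>R \<alpha>) = 0" for c
  proof -
    define p where "p = (\<lambda>\<alpha>. max (c \<alpha>) 0)"
    define n where "n = (\<lambda>\<alpha>. max (- c \<alpha>) 0)"
    have nonneg: "0 \<le> p \<alpha>" "0 \<le> n \<alpha>" and disj: "p \<alpha> * n \<alpha> = 0" and c: "c \<alpha> = p \<alpha> - n \<alpha>" for \<alpha>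
      by (auto simp: p_def n_def max_def)
    define v where "v = (\<Sum>\<alpha>\<in>simple_roots. p \<alpha> *\<^sub>R \<alpha>)"
    have v: "v = (\<Sum>\<alpha>\<in>simple_roots. n \<alpha> *\<^sub>R \<alpha>)"
      using rel by (simp add: v_def c scaleR_diff_left sum_subtractf)
    have "v \<bullet> v = (\<Sum>\<alpha>\<in>simple_roots. \<Sum>\<beta>\<in>simple_roots. p \<alpha> * n \<beta> * (\<alpha> \<bullet> \<beta>))"
    proof -
      have "v \<bullet> v = (\<Sum>\<alpha>\<in>simple_roots. p \<alpha> *\<^sub>R \<alpha>) \<bullet> (\<Sum>\<beta>\<in>simple_roots. n \<beta> *\<^sub>R \<beta>)"
        using v v_def by simp
      then show ?thesis
        by (simp only: inner_sum_left) (simp add: inner_sum_right sum_distrib_left ac_simps)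
    qed
    also have "\<dots> \<le> 0"
    proof (intro sum_nonpos)
      fix \<alpha> \<beta> assume *: "\<alpha> \<in> simple_roots" "\<beta> \<in> simple_roots"
      show "p \<alpha> * n \<beta> * (\<alpha> \<bullet> \<beta>) \<le> 0"
      proof (cases "\<alpha> = \<beta>")
        case True
        then show ?thesis using disj[of \<beta>] by auto
      next
        case False
        then show ?thesis
          using * nonneg simple_roots_obtuse by (intro mult_nonneg_nonpos mult_nonneg_nonneg) auto
      qed
    qed
    finally have "v = 0" by (metis inner_ge_zero inner_eq_zero_iff order_antisym)
    have zero: "q \<alpha> = 0" if "\<And>\<alpha>. 0 \<le> q \<alpha>" "(\<Sum>\<alpha>\<in>simple_roots. q \<alpha> *\<^sub>R \<alpha>) = 0" "\<alpha> \<in> simple_roots"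
      for q :: "'a \<Rightarrow> real" and \<alpha>
    proof -
      have "(\<Sum>\<alpha>\<in>simple_roots. q \<alpha> * (\<alpha> \<bullet> b)) = (\<Sum>\<alpha>\<in>simple_roots. q \<alpha> *\<^sub>R \<alpha>) \<bullet> b"
        by (simp add: inner_sum_left)
      then have "(\<Sum>\<alpha>\<in>simple_roots. q \<alpha> * (\<alpha> \<bullet> b)) = 0" using that(2) by simp
      moreover have "0 \<le> q \<alpha> * (\<alpha> \<bullet> b)" if "\<alpha> \<in> simple_roots" for \<alpha>
        using \<open>\<And>\<alpha>. 0 \<le> q \<alpha>\<close> simple_root_base[OF that]
        by (intro mult_nonneg_nonneg) (auto intro: less_imp_le)
      ultimately have "q \<alpha> * (\<alpha> \<bullet> b) = 0"
        using that(3) sum_nonneg_eq_0_iff[OF finite_simple_roots, of "\<lambda>\<alpha>. q \<alpha> * (\<alpha> \<bullet> b)"] by auto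
      then show ?thesis using simple_root_base[OF that(3)] by simp
    qed
    show ?thesis
      using zero[of p] zero[of n] nonneg v v_def \<open>v = 0\<close> c by simp
  qed
  then show ?thesis
    using finite_simple_roots by (auto simp: independent_explicit dependent_finite)
qed

lemma dominant_if_maximal:
  assumes a: "a \<in> B" and max: "\<And>\<alpha>. \<alpha> \<in> simple_roots \<Longrightarrow> reflection \<alpha> x \<bullet> a \<le> x \<bullet> a"
  shows "x \<in> closure B"
  unfolding in_closure_chamber_simple_iff
proof (clarify)
  fix \<alpha> assume \<alpha>: "\<alpha> \<in> simple_roots"
  have "0 \<le> (x \<bullet> \<alpha>) * (\<alpha> \<bullet> a)"
    using max[OF \<alpha>] inner_root_self[OF simple_root_is_root[OF \<alpha>]] by (simp add: inner_reflection mult.commute)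
  moreover have "0 < \<alpha> \<bullet> a" using a \<alpha> simple_roots_pos unfolding in_chamber_iff by auto
  ultimately show "0 \<le> \<alpha> \<bullet> x" by (simp add: zero_le_mult_iff inner_commute)
qed

lemma simple_reflection_comp: "g \<in> W \<Longrightarrow> \<alpha> \<in> simple_roots \<Longrightarrow> reflection \<alpha> \<circ> g \<in> W"
  by (intro comp_in_group reflection_root simple_root_is_root)

text \<open>
  The orbit point with the largest inner product with \<open>a\<close> is the one closest to \<open>a\<close>; no simple
  reflection brings it closer, so it is on the positive side of every wall.
\<close>

lemma fundamental_orbit:
  assumes a: "a \<in> B"
  obtains g where "g \<in> W" "g x \<in> closure B" "\<forall>h\<in>W. h x \<bullet> a \<le> g x \<bullet> a"
proof -
  have "W \<noteq> {}" using id_in_group by auto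
  then obtain g where g: "g \<in> W" and max: "\<And>h. h \<in> W \<Longrightarrow> h x \<bullet> a \<le> g x \<bullet> a"
    using ex_is_arg_min_if_finite[OF finite_group, of "\<lambda>h. - (h x \<bullet> a)"]
    by (auto simp: is_arg_min_linorder)
  have "g x \<in> closure B"
    using max[OF simple_reflection_comp[OF g]] by (intro dominant_if_maximal[OF a]) simp
  with g max that show ?thesis by blast
qed

lemma simple_word_in_group:
  assumes "xs \<in> lists simple_roots"
  shows "refl_word xs \<in> W"
proof -
  have "xs \<in> lists (roots W)" using assms simple_root_is_root by (auto simp: in_lists_conv_set)
  then have "refl_word xs \<in> refl_word ` lists (roots W)" by (rule imageI)
  then show ?thesis by (simp only: roots_generate[symmetric])
qed

text \<open>
  Among the positive roots conjugate to a given one by a product of simple reflections, consider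
  the one of least height \<open>\<gamma> \<bullet> b\<close>. As \<open>- \<gamma>\<close> is not in the closed chamber, some simple \<open>\<alpha>\<close> has
  \<open>\<gamma> \<bullet> \<alpha> > 0\<close>; reflecting in \<open>\<alpha>\<close> lowers the height, so it must make \<open>\<gamma>\<close> negative, whence
  \<open>\<gamma> = \<alpha>\<close>.
\<close>

lemma pos_root_conj_simple:
  assumes \<beta>: "\<beta> \<in> pos_roots"
  obtains xs \<alpha> where "xs \<in> lists simple_roots" "\<alpha> \<in> simple_roots" "refl_word xs \<beta> = \<alpha>"
proof -
  let ?X = "{\<gamma> \<in> pos_roots. \<exists>xs\<in>lists simple_roots. refl_word xs \<beta> = \<gamma>}"
  have "\<beta> \<in> ?X" using \<beta> by (auto intro!: bexI[of _ "[]"])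
  then obtain \<gamma> where \<gamma>: "\<gamma> \<in> ?X" and min: "\<And>\<delta>. \<delta> \<in> ?X \<Longrightarrow> \<gamma> \<bullet> b \<le> \<delta> \<bullet> b"
    using ex_is_arg_min_if_finite[of ?X "\<lambda>\<gamma>. \<gamma> \<bullet> b"] finite_pos_roots
    by (auto simp: is_arg_min_linorder)
  obtain xs where xs: "xs \<in> lists simple_roots" "refl_word xs \<beta> = \<gamma>" using \<gamma> by auto
  have "- \<gamma> \<notin> closure B"
    using \<gamma> inner_root_self[of \<gamma>] pos_root_is_root[of \<gamma>] unfolding in_closure_chamber_iff by force
  then obtain \<alpha> where \<alpha>: "\<alpha> \<in> simple_roots" "0 < \<gamma> \<bullet> \<alpha>"
    unfolding in_closure_chamber_simple_iff by (force simp: inner_commute)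
  have "reflection \<alpha> \<gamma> \<bullet> b < \<gamma> \<bullet> b"
    using \<alpha> inner_root_self[OF simple_root_is_root[OF \<alpha>(1)]] simple_root_base[OF \<alpha>(1)]
    by (simp add: inner_reflection)
  then have "reflection \<alpha> \<gamma> \<notin> ?X" using min by force
  moreover have "refl_word (\<alpha> # xs) \<beta> = reflection \<alpha> \<gamma>" "\<alpha> # xs \<in> lists simple_roots"
    using xs \<alpha> by auto
  ultimately have "reflection \<alpha> \<gamma> \<notin> pos_roots" by blast
  then have "\<gamma> = \<alpha>" using simple_reflection_pos[OF \<alpha>(1)] \<gamma> by blast
  with xs \<alpha>(1) that show ?thesis by blast
qed

lemma reflection_root_simple_word:
  assumes "\<beta> \<in> roots W"
  shows "reflection \<beta> \<in> refl_word ` lists simple_roots"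
proof -
  have "reflection \<beta> \<in> refl_word ` lists simple_roots" if \<beta>: "\<beta> \<in> pos_roots" for \<beta>
  proof -
    obtain xs \<alpha> where xs: "xs \<in> lists simple_roots" "\<alpha> \<in> simple_roots" "refl_word xs \<beta> = \<alpha>"
      using pos_root_conj_simple[OF \<beta>] by blast
    have "refl_word xs \<circ> reflection \<beta> = reflection \<alpha> \<circ> refl_word xs"
      using reflection_conj[OF orthogonal_transformation_refl_word, of xs \<beta>] xs(3) by simp
    then have "refl_word (rev xs) \<circ> (reflection \<alpha> \<circ> refl_word xs)
        = (refl_word (rev xs) \<circ> refl_word xs) \<circ> reflection \<beta>"
      by (simp only: comp_assoc)
    then have "reflection \<beta> = refl_word (rev xs @ \<alpha> # xs)"
      by (simp only: refl_word_append refl_word_rev refl_word_Cons id_comp)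
    then show ?thesis using xs(1,2) by (intro image_eqI[of _ _ "rev xs @ \<alpha> # xs"]) auto
  qed
  then show ?thesis using root_pos_or_neg[OF assms] reflection_minus by metis
qed

lemma simple_roots_generate: "W = refl_word ` lists simple_roots"
proof
  have "refl_word xs \<in> refl_word ` lists simple_roots" if "xs \<in> lists (roots W)" for xs
    using that
  proof (induction xs)
    case Nil
    show ?case by (intro image_eqI[of _ _ "[]"]) auto
  next
    case (Cons \<beta> xs)
    then obtain ys zs where "ys \<in> lists simple_roots" "reflection \<beta> = refl_word ys"
      "zs \<in> lists simple_roots" "refl_word xs = refl_word zs"
      using reflection_root_simple_word[of \<beta>] by auto
    then show ?case by (intro image_eqI[of _ _ "ys @ zs"]) (auto simp: refl_word_append)
  qed
  then have "refl_word ` lists (roots W) \<subseteq> refl_word ` lists simple_roots"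
    by (rule image_subsetI)
  then show "W \<subseteq> refl_word ` lists simple_roots" by (simp only: roots_generate[symmetric])
  show "refl_word ` lists simple_roots \<subseteq> W"
    by (rule image_subsetI) (rule simple_word_in_group)
qed

lemma span_roots_eq: "span (roots W) = span simple_roots"
proof
  show "span simple_roots \<subseteq> span (roots W)"
    using simple_root_is_root by (intro span_mono) auto
  have "\<beta> \<in> span simple_roots" if "\<beta> \<in> roots W" for \<beta>
    using reflection_root_simple_word[OF that] by (rule root_in_span)
  then show "span (roots W) \<subseteq> span simple_roots"
    by (intro span_minimal subspace_span) auto
qed

lemma reflection_rank_dim: "reflection_rank W B = dim (roots W)"
proof -
  have "dim (roots W) = dim (span simple_roots)" unfolding span_roots_eq[symmetric] by simp
  also have "\<dots> = card simple_roots" using dim_eq_card_independent[OF independent_simple_roots] by simp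
  finally show ?thesis by (simp add: reflection_rank_eq)
qed

subsection \<open>The closed chamber is a fundamental domain\<close>

text \<open>
  The exchange condition: reading the word from the right, \<open>\<alpha>\<close> turns negative at some letter, and
  at that moment it has become the root of that letter.
\<close>

lemma exchange:
  assumes "xs \<in> lists simple_roots" "\<alpha> \<in> simple_roots" "refl_word xs \<alpha> \<notin> pos_roots"
  obtains ys where "ys \<in> lists simple_roots" "length xs = Suc (length ys)"
    "refl_word xs \<circ> reflection \<alpha> = refl_word ys"
proof -
  have "\<exists>ys\<in>lists simple_roots. length xs = Suc (length ys) \<and>
      refl_word xs \<circ> reflection \<alpha> = refl_word ys"
    using assms(1,3)
  proof (induction xs)
    case Nil
    then show ?case using assms(2) simple_roots_pos by auto
  next
    case (Cons \<beta> xs)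
    have \<beta>: "\<beta> \<in> simple_roots" and xs: "xs \<in> lists simple_roots" using Cons.hyps by auto
    show ?case
    proof (cases "refl_word xs \<alpha> \<in> pos_roots")
      case True
      then have eq: "refl_word xs \<alpha> = \<beta>"
        using Cons.prems simple_reflection_pos[OF \<beta> True] by auto
      have "refl_word (\<beta> # xs) \<circ> reflection \<alpha> = reflection \<beta> \<circ> (reflection \<beta> \<circ> refl_word xs)"
        using reflection_conj[OF orthogonal_transformation_refl_word, of xs \<alpha>]
        by (simp add: eq comp_assoc)
      also have "\<dots> = refl_word xs" by (simp add: fun_eq_iff)
      finally show ?thesis using xs by (intro bexI[of _ xs] conjI) (simp, assumption+)
    next
      case False
      then obtain ys where ys: "ys \<in> lists simple_roots" "length xs = Suc (length ys)"
        and eq: "refl_word xs \<circ> reflection \<alpha> = refl_word ys"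
        using Cons.IH by blast
      have "refl_word (\<beta> # xs) \<circ> reflection \<alpha> = refl_word (\<beta> # ys)"
        by (simp only: refl_word_Cons comp_assoc eq)
      moreover have "\<beta> # ys \<in> lists simple_roots" "length (\<beta> # xs) = Suc (length (\<beta> # ys))"
        using \<beta> ys by auto
      ultimately show ?thesis by blast
    qed
  qed
  then show ?thesis using that by blast
qed

text \<open>
  Induction on the length of a shortest word for \<open>g\<close>. Its last letter \<open>\<alpha>\<close> has \<open>g \<alpha>\<close> negative, and
  then \<open>0 \<le> \<alpha> \<bullet> x = g \<alpha> \<bullet> g x \<le> 0\<close>, so \<open>\<alpha>\<close> fixes \<open>x\<close> and can be split off.
\<close>

lemma closed_chamber_stabilizer_aux:
  assumes "xs \<in> lists simple_roots" "x \<in> closure B" "refl_word xs x \<in> closure B"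
  shows "refl_word xs x = x \<and> refl_word xs \<in> refl_word ` lists {\<alpha> \<in> simple_roots. \<alpha> \<bullet> x = 0}"
  using assms
proof (induction "length xs" arbitrary: xs rule: less_induct)
  case less
  let ?D = "{\<alpha> \<in> simple_roots. \<alpha> \<bullet> x = 0}"
  show ?case
  proof (cases "\<exists>ys\<in>lists simple_roots. length ys < length xs \<and> refl_word ys = refl_word xs")
    case True
    then obtain ys where ys: "ys \<in> lists simple_roots" "length ys < length xs"
      and eq: "refl_word ys = refl_word xs" by blast
    show ?thesis using less.hyps[OF ys(2,1)] less.prems(2,3) unfolding eq by blast
  next
    case False
    then have shortest: "refl_word ys \<noteq> refl_word xs"
      if "ys \<in> lists simple_roots" "length ys < length xs" for ys
      using that by blast
    show ?thesis
    proof (cases xs rule: rev_cases)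
      case Nil
      then show ?thesis by (auto intro!: image_eqI[of _ _ "[]"])
    next
      case (snoc ys \<alpha>)
      then have ys: "ys \<in> lists simple_roots" and \<alpha>: "\<alpha> \<in> simple_roots" using less.prems by auto
      have xs: "refl_word xs = refl_word ys \<circ> reflection \<alpha>" by (simp add: snoc refl_word_append)
      have "refl_word ys \<alpha> \<in> pos_roots"
      proof (rule ccontr)
        assume "refl_word ys \<alpha> \<notin> pos_roots"
        then obtain zs where "zs \<in> lists simple_roots" "length ys = Suc (length zs)"
          "refl_word ys \<circ> reflection \<alpha> = refl_word zs"
          using exchange[OF ys \<alpha>] by blast
        then show False using shortest[of zs] xs snoc by simp
      qed
      then have "0 \<le> refl_word ys \<alpha> \<bullet> refl_word xs x"
        using less.prems unfolding in_closure_chamber_iff by auto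
      also have "refl_word ys \<alpha> \<bullet> refl_word xs x = \<alpha> \<bullet> reflection \<alpha> x"
        using inner_in_group[OF simple_word_in_group[OF ys]] by (simp add: xs)
      also have "\<dots> = - (\<alpha> \<bullet> x)"
        using inner_root_self[OF simple_root_is_root[OF \<alpha>]]
        by (simp add: inner_commute[of \<alpha> "reflection \<alpha> x"] inner_commute[of x \<alpha>] inner_reflection)
      finally have "\<alpha> \<bullet> x \<le> 0" by simp
      moreover have "0 \<le> \<alpha> \<bullet> x" using less.prems \<alpha> unfolding in_closure_chamber_simple_iff by auto
      ultimately have \<alpha>x: "\<alpha> \<bullet> x = 0" by simp
      then have "refl_word xs x = refl_word ys x"
        by (simp add: xs reflection_fix inner_commute)
      then have IH: "refl_word ys x = x \<and> refl_word ys \<in> refl_word ` lists ?D"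
        using less.hyps[of ys] less.prems ys snoc by simp
      then obtain zs where zs: "zs \<in> lists ?D" "refl_word ys = refl_word zs" by auto
      have "refl_word xs = refl_word (zs @ [\<alpha>])" by (simp add: xs zs refl_word_append)
      moreover have "zs @ [\<alpha>] \<in> lists ?D" using zs \<alpha> \<alpha>x by auto
      ultimately show ?thesis using IH \<open>refl_word xs x = refl_word ys x\<close> by auto
    qed
  qed
qed

lemma closed_chamber_stabilizer:
  assumes "g \<in> W" "x \<in> closure B" "g x \<in> closure B"
  shows "g x = x" "g \<in> refl_word ` lists {\<alpha> \<in> simple_roots. \<alpha> \<bullet> x = 0}"
proof -
  obtain xs where "xs \<in> lists simple_roots" "g = refl_word xs"
    using simple_roots_generate assms(1) by blast
  then show "g x = x" "g \<in> refl_word ` lists {\<alpha> \<in> simple_roots. \<alpha> \<bullet> x = 0}"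
    using closed_chamber_stabilizer_aux assms(2,3) by blast+
qed

text \<open>
  The maximum of the inner product with \<open>a\<close> over an orbit is attained only in the closed chamber,
  which contains just one point of the orbit.
\<close>

lemma dominant_maximal:
  assumes g: "g \<in> W" and x: "x \<in> closure B" and a: "a \<in> B" and eq: "g x \<bullet> a = x \<bullet> a"
  shows "g x = x"
proof -
  obtain h where h: "h \<in> W" "h x \<in> closure B" "\<forall>k\<in>W. k x \<bullet> a \<le> h x \<bullet> a"
    using fundamental_orbit[OF a] .
  have "h x = x" using closed_chamber_stabilizer(1)[OF h(1) x h(2)] .
  with h(3) have max: "k x \<bullet> a \<le> x \<bullet> a" if "k \<in> W" for k using that by metis
  have "g x \<in> closure B"
    using max[OF simple_reflection_comp[OF g]] eq by (intro dominant_if_maximal[OF a]) simp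
  then show "g x = x" by (rule closed_chamber_stabilizer(1)[OF g x])
qed

section \<open>Maximal parabolic subgroups and facets of the orbit polytope\<close>

definition parabolic :: "'a \<Rightarrow> ('a \<Rightarrow> 'a) set" where
  "parabolic \<alpha> = refl_word ` lists (simple_roots - {\<alpha>})"

definition parabolic_cosets :: "'a \<Rightarrow> ('a \<Rightarrow> 'a) set set" where
  "parabolic_cosets \<alpha> = (\<lambda>w. (\<circ>) w ` parabolic \<alpha>) ` W"

lemma max_parabolic_eq:
  assumes "\<alpha> \<in> simple_roots"
  shows "max_parabolic W B (reflection \<alpha>) = parabolic \<alpha>"
proof -
  have "simple_reflections W B - {reflection \<alpha>} = reflection ` (simple_roots - {\<alpha>})"
    using assms inj_on_image_set_diff[OF inj_on_reflection_simple, of simple_roots "{\<alpha>}"]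
    by (simp add: simple_reflections_eq)
  then show ?thesis
    by (simp add: max_parabolic_def parabolic_def group_generated_reflections)
qed

lemma parabolic_subset: "parabolic \<alpha> \<subseteq> W"
  unfolding parabolic_def by (rule image_subsetI, rule simple_word_in_group) auto

lemma id_in_parabolic: "id \<in> parabolic \<alpha>"
  unfolding parabolic_def by (rule id_in_refl_words)

lemma finite_parabolic: "finite (parabolic \<alpha>)"
  using parabolic_subset finite_group finite_subset by blast

lemma parabolic_reflection_group: "finite_reflection_group (parabolic \<alpha>)"
proof -
  have "0 \<notin> simple_roots - {\<alpha>}" using simple_root_base by fastforce
  moreover have "parabolic \<alpha> = group_generated (reflection ` (simple_roots - {\<alpha>}))"
    by (simp add: parabolic_def group_generated_reflections)
  ultimately show ?thesis
    unfolding finite_reflection_group_def using finite_parabolic by blast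
qed

lemma roots_parabolic: "roots (parabolic \<alpha>) \<subseteq> roots W"
  using parabolic_subset by (auto simp: roots_def)

text \<open>
  The fundamental weight of \<open>\<alpha>\<close>, up to a positive factor, is the component of \<open>\<alpha>\<close> orthogonal to all other simple roots.
\<close>

lemma fundamental_weight:
  assumes \<alpha>: "\<alpha> \<in> simple_roots"
  obtains \<omega> where "\<omega> \<in> span simple_roots" "0 < \<alpha> \<bullet> \<omega>"
    "\<forall>\<beta>\<in>simple_roots - {\<alpha>}. \<beta> \<bullet> \<omega> = 0"
proof -
  let ?D = "simple_roots - {\<alpha>}"
  obtain y z where y: "y \<in> span ?D" and z: "\<And>w. w \<in> span ?D \<Longrightarrow> orthogonal z w"
    and \<alpha>_eq: "\<alpha> = y + z"
    using orthogonal_subspace_decomp_exists[of ?D \<alpha>] by metis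
  have "\<alpha> \<notin> span ?D" using independent_simple_roots \<alpha> by (auto simp: dependent_def)
  then have "z \<noteq> 0" using y \<alpha>_eq by auto
  have "\<alpha> \<bullet> z = z \<bullet> z"
    using z[OF y] by (simp add: \<alpha>_eq inner_add_left inner_commute[of y z] orthogonal_def)
  then have "0 < \<alpha> \<bullet> z" using \<open>z \<noteq> 0\<close> by simp
  moreover have "z = \<alpha> - y" using \<alpha>_eq by simp
  then have "z \<in> span simple_roots"
    using \<alpha> y span_mono[of ?D simple_roots] by (auto intro: span_diff span_base)
  moreover have "\<beta> \<bullet> z = 0" if "\<beta> \<in> ?D" for \<beta>
    using z[OF span_base[OF that]] by (simp add: orthogonal_def inner_commute)
  ultimately show ?thesis using that by blast
qed

lemma fundamental_weight_in_closure:
  assumes "0 < \<alpha> \<bullet> \<omega>" and "\<forall>\<beta>\<in>simple_roots - {\<alpha>}. \<beta> \<bullet> \<omega> = 0"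
  shows "\<omega> \<in> closure B"
  unfolding in_closure_chamber_simple_iff
proof
  fix \<beta> assume "\<beta> \<in> simple_roots"
  then show "0 \<le> \<beta> \<bullet> \<omega>" using assms by (cases "\<beta> = \<alpha>") auto
qed

lemma stabilizer_fundamental_weight:
  assumes \<alpha>: "\<alpha> \<in> simple_roots" "0 < \<alpha> \<bullet> \<omega>"
    and \<omega>: "\<forall>\<beta>\<in>simple_roots - {\<alpha>}. \<beta> \<bullet> \<omega> = 0"
    and g: "g \<in> W"
  shows "g \<in> parabolic \<alpha> \<longleftrightarrow> g \<omega> = \<omega>"
proof -
  have cl: "\<omega> \<in> closure B" using fundamental_weight_in_closure[OF \<alpha>(2) \<omega>] .
  have eq: "{\<beta> \<in> simple_roots. \<beta> \<bullet> \<omega> = 0} = simple_roots - {\<alpha>}"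
    using \<alpha> \<omega> by auto
  show "g \<in> parabolic \<alpha> \<longleftrightarrow> g \<omega> = \<omega>"
  proof
    assume "g \<in> parabolic \<alpha>"
    then obtain xs where "xs \<in> lists (simple_roots - {\<alpha>})" "g = refl_word xs"
      by (auto simp: parabolic_def)
    then show "g \<omega> = \<omega>" using \<omega> by (auto intro!: refl_word_fix simp: inner_commute)
  next
    assume "g \<omega> = \<omega>"
    then show "g \<in> parabolic \<alpha>"
      using closed_chamber_stabilizer(2)[OF g cl] cl by (simp add: eq parabolic_def)
  qed
qed

lemma group_preserves_span:
  assumes "w \<in> W"
  shows "w x - x \<in> span simple_roots"
proof -
  have "w \<in> refl_word ` lists simple_roots" using assms simple_roots_generate by (rule subst[rotated])
  then show ?thesis using refl_word_diff_in_span by (auto simp: in_lists_conv_set)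
qed

text \<open>
  With \<open>\<omega>\<close> the fundamental weight of \<open>\<alpha>\<close> and \<open>w\<close> in the coset, the functional is \<open>v = w \<omega>\<close> and the
  value is \<open>c a = \<omega> \<bullet> a\<close>. It is taken at \<open>u a\<close> iff the inverse of \<open>u\<close> carries \<open>w \<omega>\<close> to the only
  point of its orbit that maximises the inner product with \<open>a\<close>, namely \<open>\<omega>\<close>; that is, iff \<open>u\<close> and \<open>w\<close>
  differ by an element of the stabilizer of \<open>\<omega>\<close>.
\<close>

lemma facet_functional:
  assumes \<alpha>: "\<alpha> \<in> simple_roots" and D: "D \<in> parabolic_cosets \<alpha>"
  obtains v c where "v \<in> span simple_roots" "v \<noteq> 0"
    "\<forall>a\<in>B. \<forall>u\<in>W. u \<in> D \<longleftrightarrow> v \<bullet> u a = c a"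
proof -
  obtain \<omega> where \<omega>: "\<omega> \<in> span simple_roots" "0 < \<alpha> \<bullet> \<omega>"
    "\<forall>\<beta>\<in>simple_roots - {\<alpha>}. \<beta> \<bullet> \<omega> = 0"
    using fundamental_weight[OF \<alpha>] by blast
  have cl: "\<omega> \<in> closure B" using fundamental_weight_in_closure[OF \<omega>(2,3)] .
  obtain w where w: "w \<in> W" "D = (\<circ>) w ` parabolic \<alpha>"
    using D by (auto simp: parabolic_cosets_def)
  obtain w' where w': "w' \<in> W" "w' \<circ> w = id" "w \<circ> w' = id" using inverse_in_group[OF w(1)] .
  have "w \<omega> = (w \<omega> - \<omega>) + \<omega>" by simp
  then have "w \<omega> \<in> span simple_roots"
    using group_preserves_span[OF w(1), of \<omega>] \<omega>(1) span_add by metis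
  moreover have "w \<omega> \<noteq> 0"
  proof
    assume "w \<omega> = 0"
    then have "\<omega> \<bullet> \<omega> = 0" using inner_in_group[OF w(1), of \<omega> \<omega>] by simp
    with \<omega>(2) show False by simp
  qed
  moreover have "u \<in> D \<longleftrightarrow> w \<omega> \<bullet> u a = \<omega> \<bullet> a" if a: "a \<in> B" and u: "u \<in> W" for a u
  proof -
    let ?g = "w' \<circ> u"
    have g: "?g \<in> W" using comp_in_group[OF w'(1) u] .
    have wg: "w \<circ> ?g = u" using w'(3) by (simp flip: comp_assoc)
    have "u \<in> D \<longleftrightarrow> ?g \<in> parabolic \<alpha>"
    proof
      assume "u \<in> D"
      then obtain p where p: "p \<in> parabolic \<alpha>" "u = w \<circ> p" using w(2) by auto
      have "?g = p" unfolding p(2) using w'(2) by (simp flip: comp_assoc)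
      then show "?g \<in> parabolic \<alpha>" using p(1) by simp
    next
      assume "?g \<in> parabolic \<alpha>"
      then have "w \<circ> ?g \<in> D" unfolding w(2) by (rule imageI)
      then show "u \<in> D" by (simp only: wg)
    qed
    also have "\<dots> \<longleftrightarrow> ?g \<omega> = \<omega>" by (rule stabilizer_fundamental_weight[OF \<alpha> \<omega>(2,3) g])
    also have "\<dots> \<longleftrightarrow> w \<omega> \<bullet> u a = \<omega> \<bullet> a"
    proof -
      obtain k where k: "k \<in> W" "k \<circ> ?g = id" "?g \<circ> k = id" using inverse_in_group[OF g] .
      have "w \<omega> \<bullet> u a = w \<omega> \<bullet> w (?g a)" using fun_cong[OF wg, of a] by simp
      also have "\<dots> = \<omega> \<bullet> ?g a" by (rule inner_in_group[OF w(1)])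
      also have "\<dots> = k \<omega> \<bullet> a" by (rule inner_in_group_adjoint[OF g k(2)])
      finally have "w \<omega> \<bullet> u a = \<omega> \<bullet> a \<longleftrightarrow> k \<omega> \<bullet> a = \<omega> \<bullet> a" by simp
      also have "\<dots> \<longleftrightarrow> k \<omega> = \<omega>" using dominant_maximal[OF k(1) cl a] by auto
      also have "\<dots> \<longleftrightarrow> ?g \<omega> = \<omega>"
        using fun_cong[OF k(2), of \<omega>] fun_cong[OF k(3), of \<omega>] by auto
      finally show ?thesis by simp
    qed
    finally show ?thesis .
  qed
  ultimately show ?thesis using that[of "w \<omega>" "\<lambda>a. \<omega> \<bullet> a"] by blast
qed

lemma coset_subset:
  assumes "D \<in> parabolic_cosets \<alpha>"
  shows "D \<subseteq> W"
proof -
  obtain w where "w \<in> W" "D = (\<circ>) w ` parabolic \<alpha>" using assms by (auto simp: parabolic_cosets_def)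
  then show ?thesis using parabolic_subset comp_in_group by blast
qed

lemma inj_on_comp_left: "w \<in> W \<Longrightarrow> inj_on ((\<circ>) w) X"
  by (rule inj_onI) (metis bij_in_group bij_is_inj fun.inj_map injD)

lemma card_coset: "D \<in> parabolic_cosets \<alpha> \<Longrightarrow> card D = card (parabolic \<alpha>)"
  using inj_on_comp_left by (auto simp: parabolic_cosets_def intro!: card_image)

lemma coset_comp_right:
  assumes "D \<in> parabolic_cosets \<alpha>" "g \<in> D" "p \<in> parabolic \<alpha>"
  shows "g \<circ> p \<in> D"
proof -
  obtain w where w: "D = (\<circ>) w ` parabolic \<alpha>" using assms(1) by (auto simp: parabolic_cosets_def)
  then obtain q where q: "q \<in> parabolic \<alpha>" "g = w \<circ> q" using assms(2) by auto
  have "q \<circ> p \<in> parabolic \<alpha>"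
    using q(1) assms(3) unfolding parabolic_def by (rule comp_in_refl_words)
  then have "w \<circ> (q \<circ> p) \<in> D" unfolding w by (rule imageI)
  then show ?thesis by (simp only: q(2) comp_assoc)
qed

lemma coset_eq:
  assumes w: "w \<in> W" and g: "g \<in> (\<circ>) w ` parabolic \<alpha>"
  shows "(\<circ>) g ` parabolic \<alpha> = (\<circ>) w ` parabolic \<alpha>"
proof
  obtain p where p: "p \<in> parabolic \<alpha>" "g = w \<circ> p" using g by auto
  obtain q where q: "q \<in> parabolic \<alpha>" "p \<circ> q = id"
    using p(1) inverse_in_refl_words unfolding parabolic_def by metis
  show "(\<circ>) g ` parabolic \<alpha> \<subseteq> (\<circ>) w ` parabolic \<alpha>"
    using coset_comp_right[OF _ g] w by (auto simp: parabolic_cosets_def)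
  show "(\<circ>) w ` parabolic \<alpha> \<subseteq> (\<circ>) g ` parabolic \<alpha>"
  proof (rule image_subsetI)
    fix r assume "r \<in> parabolic \<alpha>"
    then have "q \<circ> r \<in> parabolic \<alpha>"
      using q(1) unfolding parabolic_def by (intro comp_in_refl_words)
    then have "g \<circ> (q \<circ> r) \<in> (\<circ>) g ` parabolic \<alpha>" by (rule imageI)
    moreover have "g \<circ> (q \<circ> r) = w \<circ> ((p \<circ> q) \<circ> r)" by (simp only: p(2) comp_assoc)
    ultimately show "w \<circ> r \<in> (\<circ>) g ` parabolic \<alpha>" by (simp only: q(2) id_comp)
  qed
qed

lemma card_group: "card W = card (parabolic_cosets \<alpha>) * card (parabolic \<alpha>)"
proof -
  let ?f = "\<lambda>w. (\<circ>) w ` parabolic \<alpha>"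
  have "{w \<in> W. ?f w = D} = D" if D: "D \<in> parabolic_cosets \<alpha>" for D
  proof
    show "{w \<in> W. ?f w = D} \<subseteq> D"
      using id_in_parabolic by (auto intro!: image_eqI[of _ _ id])
    obtain w where w: "w \<in> W" "D = ?f w" using D by (auto simp: parabolic_cosets_def)
    show "D \<subseteq> {w \<in> W. ?f w = D}"
    proof
      fix g assume g: "g \<in> D"
      then have "?f g = D" using coset_eq[OF w(1)] unfolding w(2) by blast
      then show "g \<in> {w \<in> W. ?f w = D}" using g coset_subset[OF D] by blast
    qed
  qed
  then have "(\<Sum>D\<in>parabolic_cosets \<alpha>. card {w \<in> W. ?f w = D})
      = card (parabolic_cosets \<alpha>) * card (parabolic \<alpha>)"
    by (simp add: card_coset)
  moreover have "card W = (\<Sum>D\<in>?f ` W. card {w \<in> W. ?f w = D})"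
    using finite_group sum.image_gen[OF finite_group, of "\<lambda>_. 1::nat" ?f] by simp
  ultimately show ?thesis by (simp add: parabolic_cosets_def)
qed

subsection \<open>The rank of a maximal parabolic subgroup\<close>

text \<open>
  The subgroup moves points only in the directions spanned by its generating roots, so all of its
  roots lie in their span.
\<close>

lemma dim_roots_parabolic:
  assumes \<alpha>: "\<alpha> \<in> simple_roots"
  shows "dim (roots (parabolic \<alpha>)) = card simple_roots - 1"
proof -
  let ?D = "simple_roots - {\<alpha>}"
  have "roots (parabolic \<alpha>) \<subseteq> span ?D" using root_in_span by (auto simp: roots_def parabolic_def)
  moreover have "reflection \<beta> \<in> parabolic \<alpha>" if "\<beta> \<in> ?D" for \<beta>
    unfolding parabolic_def using that by (intro image_eqI[of _ _ "[\<beta>]"]) auto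
  then have "?D \<subseteq> roots (parabolic \<alpha>)"
    using norm_root simple_root_is_root by (auto simp: roots_def)
  ultimately have "dim (roots (parabolic \<alpha>)) = dim ?D"
    by (intro antisym) (metis dim_span dim_subset, rule dim_subset)
  also have "\<dots> = card ?D"
    by (rule dim_eq_card_independent) (rule independent_mono[OF independent_simple_roots], blast)
  finally show ?thesis using \<alpha> finite_simple_roots by simp
qed

lemma parabolic_rank:
  assumes \<alpha>: "\<alpha> \<in> simple_roots" and C: "chamber (parabolic \<alpha>) C"
  shows "reflection_rank (parabolic \<alpha>) C = card simple_roots - 1"
proof -
  obtain c where c: "c \<in> C" using in_components_nonempty[OF C[unfolded chamber_def]] by blast
  interpret P: reflection_chamber "parabolic \<alpha>" C c
    by (rule reflection_chamber.intro[OF parabolic_reflection_group C c])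
  show ?thesis using P.reflection_rank_dim dim_roots_parabolic[OF \<alpha>] by simp
qed

text \<open>
  Since \<open>B\<close> is connected and avoids the hyperplanes of the subgroup, it lies in one of the
  subgroup's chambers, and the subgroup permutes its chambers transitively.
\<close>

lemma chamber_into_parabolic_chamber:
  assumes C: "chamber (parabolic \<alpha>) C"
  obtains g where "g \<in> parabolic \<alpha>" "g ` B \<subseteq> C"
proof -
  obtain c where c: "c \<in> C" using in_components_nonempty[OF C[unfolded chamber_def]] by blast
  interpret P: reflection_chamber "parabolic \<alpha>" C c
    by (rule reflection_chamber.intro[OF parabolic_reflection_group C c])
  obtain g where g: "g \<in> parabolic \<alpha>" "g b \<in> closure C"
    using P.fundamental_orbit[OF c] .
  obtain h where h: "h \<in> parabolic \<alpha>" "h \<circ> g = id" using P.inverse_in_group[OF g(1)] by blast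
  have regular: "\<beta> \<bullet> g a \<noteq> 0" if "a \<in> B" "\<beta> \<in> roots (parabolic \<alpha>)" for a \<beta>
  proof -
    have "h \<beta> \<in> roots W" using P.group_root[OF h(1) that(2)] roots_parabolic by blast
    then show ?thesis
      using root_regular[OF _ that(1)] P.inner_in_group_adjoint[OF g(1) h(2)] by simp
  qed
  have "g b \<in> C" using P.regular_in_closure_chamber[OF g(2)] regular[OF base_point] by blast
  have "connected (g ` B)"
    using in_components_connected[OF chamber[unfolded chamber_def]] P.linear_in_group[OF g(1)]
    by (intro connected_continuous_image linear_continuous_on) (simp_all add: linear_conv_bounded_linear)
  moreover have "g ` B \<subseteq> - (\<Union>\<beta>\<in>roots (parabolic \<alpha>). root_hyperplane \<beta>)"
    using regular by (auto simp: root_hyperplane_def)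
  moreover have "C \<inter> g ` B \<noteq> {}" using \<open>g b \<in> C\<close> base_point by auto
  ultimately have "g ` B \<subseteq> C"
    using components_maximal[OF C[unfolded chamber_def]] by blast
  with g(1) that show ?thesis by blast
qed

section \<open>Pyramids over persistent simplices\<close>

definition orbit_points :: "('a \<Rightarrow> 'a) set \<Rightarrow> 'a \<Rightarrow> 'a set" where
  "orbit_points R a = (\<lambda>w. w a) ` R"

text \<open>
  The bases of the pyramids. For \<open>D\<close> a parabolic subgroup they have the size and dimension of its
  persistent simplices, but are tested on the chamber \<open>B\<close> of the whole group; this makes the notion
  invariant under translation of \<open>D\<close> to a coset.
\<close>

definition persistent_bases :: "('a \<Rightarrow> 'a) set \<Rightarrow> ('a \<Rightarrow> 'a) set set" where
  "persistent_bases D = {R. R \<subseteq> D \<and> card R = card simple_roots \<and>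
     (\<forall>a\<in>B. aff_dim (orbit_points R a) = int (card simple_roots) - 1)}"

lemma orbit_points_comp_left: "orbit_points ((\<circ>) w ` R) a = w ` orbit_points R a"
  by (auto simp: orbit_points_def image_image)

lemma orbit_points_comp_right: "orbit_points ((\<lambda>t. t \<circ> g) ` R) a = orbit_points R (g a)"
  by (auto simp: orbit_points_def image_image)

lemma persistent_simplex_iff:
  "persistent_simplex W B T \<longleftrightarrow> T \<subseteq> W \<and> card T = card simple_roots + 1 \<and>
     (\<forall>a\<in>B. aff_dim (orbit_points T a) = int (card simple_roots))"
proof -
  have "int (card simple_roots) simplex (convex hull (orbit_points T a))
      \<longleftrightarrow> aff_dim (orbit_points T a) = int (card simple_roots)"
    if "T \<subseteq> W" "card T = card simple_roots + 1" for a
  proof -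
    have "finite T" using that finite_group finite_subset by blast
    then have "finite (orbit_points T a)" "card (orbit_points T a) \<le> card simple_roots + 1"
      using card_image_le[of T "\<lambda>w. w a"] that by (simp_all add: orbit_points_def)
    then show ?thesis by (rule simplex_convex_hull_iff)
  qed
  then show ?thesis
    by (auto simp: persistent_simplex_def reflection_rank_eq simp flip: orbit_points_def)
qed

lemma finite_persistent_bases: "D \<subseteq> W \<Longrightarrow> finite (persistent_bases D)"
  by (rule finite_subset[of _ "Pow W"]) (auto simp: persistent_bases_def finite_group)

lemma finite_persistent_simplices: "finite {T. persistent_simplex W B T}"
  by (rule finite_subset[of _ "Pow W"]) (auto simp: persistent_simplex_def finite_group)

text \<open>
  If \<open>g\<close> carries \<open>B\<close> into the chamber \<open>C\<close> of the subgroup, then the points of \<open>T g\<close> at \<open>a \<in> B\<close>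
  are the points of \<open>T\<close> at \<open>g a \<in> C\<close>.
\<close>

lemma PersistS_parabolic_le:
  assumes \<alpha>: "\<alpha> \<in> simple_roots" and C: "chamber (parabolic \<alpha>) C"
  shows "PersistS (parabolic \<alpha>) C \<le> card (persistent_bases (parabolic \<alpha>))"
proof -
  obtain c where c: "c \<in> C" using in_components_nonempty[OF C[unfolded chamber_def]] by blast
  interpret P: reflection_chamber "parabolic \<alpha>" C c
    by (rule reflection_chamber.intro[OF parabolic_reflection_group C c])
  obtain g where g: "g \<in> parabolic \<alpha>" "g ` B \<subseteq> C"
    using chamber_into_parabolic_chamber[OF C] .
  have pos: "0 < card simple_roots" using \<alpha> finite_simple_roots by (auto simp: card_gt_0_iff)
  have rank: "card P.simple_roots = card simple_roots - 1"
    using parabolic_rank[OF \<alpha> C] P.reflection_rank_eq by simp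
  have "bij g" using P.bij_in_group[OF g(1)] .
  have inj: "inj (\<lambda>t. t \<circ> g)"
  proof (intro injI ext)
    fix s t x assume "s \<circ> g = t \<circ> g"
    moreover obtain y where "x = g y" using \<open>bij g\<close> by (metis bij_pointE)
    ultimately show "s x = t x" by (metis comp_apply)
  qed
  have "(\<lambda>t. t \<circ> g) ` T \<in> persistent_bases (parabolic \<alpha>)"
    if T: "persistent_simplex (parabolic \<alpha>) C T" for T
  proof -
    have *: "T \<subseteq> parabolic \<alpha>" "card T = card P.simple_roots + 1"
      "\<And>a. a \<in> C \<Longrightarrow> aff_dim (orbit_points T a) = int (card P.simple_roots)"
      using T P.persistent_simplex_iff by (auto simp: orbit_points_def P.orbit_points_def)
    have "(\<lambda>t. t \<circ> g) ` T \<subseteq> parabolic \<alpha>"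
      using *(1) g(1) P.comp_in_group by blast
    moreover have "card ((\<lambda>t. t \<circ> g) ` T) = card simple_roots"
      using *(2) rank pos inj by (simp add: card_image inj_on_subset[OF inj])
    moreover have "aff_dim (orbit_points ((\<lambda>t. t \<circ> g) ` T) a) = int (card simple_roots) - 1"
      if "a \<in> B" for a
    proof -
      have "g a \<in> C" using g(2) that by blast
      then show ?thesis using *(3)[of "g a"] rank pos unfolding orbit_points_comp_right by simp
    qed
    ultimately show ?thesis by (simp add: persistent_bases_def)
  qed
  then have "(`) (\<lambda>t. t \<circ> g) ` {T. persistent_simplex (parabolic \<alpha>) C T}
      \<subseteq> persistent_bases (parabolic \<alpha>)" by blast
  moreover have "inj_on ((`) (\<lambda>t. t \<circ> g)) {T. persistent_simplex (parabolic \<alpha>) C T}"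
    by (rule inj_onI) (metis inj inj_image_eq_iff)
  ultimately show ?thesis
    unfolding PersistS_def
    by (intro card_inj_on_le[OF _ _ finite_persistent_bases[OF parabolic_subset]]) auto
qed

lemma card_persistent_bases_coset:
  assumes D: "D \<in> parabolic_cosets \<alpha>"
  shows "card (persistent_bases (parabolic \<alpha>)) \<le> card (persistent_bases D)"
proof -
  obtain w where w: "w \<in> W" "D = (\<circ>) w ` parabolic \<alpha>" using D by (auto simp: parabolic_cosets_def)
  have inj: "inj ((\<circ>) w)" using inj_on_comp_left[OF w(1)] .
  have lin: "linear w" "inj w" using linear_in_group[OF w(1)] bij_in_group[OF w(1)] bij_is_inj by auto
  have "(\<circ>) w ` R \<in> persistent_bases D" if R: "R \<in> persistent_bases (parabolic \<alpha>)" for R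
  proof -
    have "(\<circ>) w ` R \<subseteq> D" using R w(2) by (auto simp: persistent_bases_def)
    moreover have "card ((\<circ>) w ` R) = card R" by (intro card_image inj_on_comp_left w(1))
    moreover have "aff_dim (orbit_points ((\<circ>) w ` R) a) = aff_dim (orbit_points R a)" for a
      unfolding orbit_points_comp_left using lin by (rule aff_dim_injective_linear_image)
    ultimately show ?thesis using R unfolding persistent_bases_def by simp
  qed
  then have "(`) ((\<circ>) w) ` persistent_bases (parabolic \<alpha>) \<subseteq> persistent_bases D" by blast
  moreover have "inj_on ((`) ((\<circ>) w)) (persistent_bases (parabolic \<alpha>))"
    by (rule inj_onI) (metis inj inj_image_eq_iff)
  ultimately show ?thesis
    by (intro card_inj_on_le[OF _ _ finite_persistent_bases[OF coset_subset[OF D]]])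
qed

text \<open>
  For every \<open>a\<close> the base lies in the hyperplane of a facet that the apex avoids, so the apex raises
  the dimension by one.
\<close>

lemma pyramid_persistent:
  assumes \<alpha>: "\<alpha> \<in> simple_roots" and D: "D \<in> parabolic_cosets \<alpha>"
    and R: "R \<in> persistent_bases D" and u: "u \<in> W - D"
  shows "persistent_simplex W B (insert u R)"
proof -
  obtain v c where "v \<in> span simple_roots" "v \<noteq> 0"
    and vc: "\<forall>a\<in>B. \<forall>u\<in>W. u \<in> D \<longleftrightarrow> v \<bullet> u a = c a"
    using facet_functional[OF \<alpha> D] .
  have RD: "R \<subseteq> D" "card R = card simple_roots"
    and dim: "\<And>a. a \<in> B \<Longrightarrow> aff_dim (orbit_points R a) = int (card simple_roots) - 1"
    using R by (auto simp: persistent_bases_def)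
  have RW: "R \<subseteq> W" using RD(1) coset_subset[OF D] by blast
  then have "finite R" using finite_group finite_subset by blast
  moreover have "u \<notin> R" using u RD(1) by blast
  ultimately have "card (insert u R) = card simple_roots + 1" using RD(2) by simp
  moreover have "aff_dim (orbit_points (insert u R) a) = int (card simple_roots)" if a: "a \<in> B" for a
  proof -
    have "orbit_points R a \<subseteq> {x. v \<bullet> x = c a}"
      using RD(1) RW bspec[OF vc a] by (auto simp: orbit_points_def)
    then have "affine hull (orbit_points R a) \<subseteq> {x. v \<bullet> x = c a}"
      by (rule hull_minimal) (rule affine_hyperplane)
    then have "u a \<notin> affine hull (orbit_points R a)" using bspec[OF vc a] u by blast
    moreover have "orbit_points (insert u R) a = insert (u a) (orbit_points R a)"
      by (simp add: orbit_points_def)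
    ultimately show ?thesis using dim[OF a] by (simp add: aff_dim_insert)
  qed
  ultimately show ?thesis using RW u by (simp add: persistent_simplex_iff)
qed

text \<open>
  The base already spans a hyperplane of the span of the roots, so the functionals of two facets
  containing it are proportional, and they take their distinguished value on the same group
  elements.
\<close>

lemma base_determines_coset_aux:
  assumes \<alpha>: "\<alpha> \<in> simple_roots" "D \<in> parabolic_cosets \<alpha>" "R \<in> persistent_bases D"
    and \<beta>: "\<beta> \<in> simple_roots" "E \<in> parabolic_cosets \<beta>" "R \<in> persistent_bases E"
  shows "E \<subseteq> D"
proof
  obtain v c where v: "v \<in> span simple_roots" "v \<noteq> 0"
    and vD: "\<forall>a\<in>B. \<forall>u\<in>W. u \<in> D \<longleftrightarrow> v \<bullet> u a = c a"
    using facet_functional[OF \<alpha>(1,2)] .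
  obtain w e where w: "w \<in> span simple_roots" "w \<noteq> 0"
    and wE: "\<forall>a\<in>B. \<forall>u\<in>W. u \<in> E \<longleftrightarrow> w \<bullet> u a = e a"
    using facet_functional[OF \<beta>(1,2)] .
  have R: "R \<subseteq> D" "R \<subseteq> E" "card R = card simple_roots"
    "aff_dim (orbit_points R b) = int (card simple_roots) - 1"
    using \<alpha>(3) \<beta>(3) base_point by (auto simp: persistent_bases_def)
  have RW: "R \<subseteq> W" using R(1) coset_subset[OF \<alpha>(2)] by blast
  have "card R \<noteq> 0" using R(3) \<alpha>(1) finite_simple_roots by auto
  then obtain r where r: "r \<in> R" by fastforce
  let ?L = "(\<lambda>x. x - r b) ` orbit_points R b"
  have "r b \<in> affine hull (orbit_points R b)" using r by (auto simp: orbit_points_def intro: hull_inc)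
  then have dimL: "int (dim ?L) = int (card simple_roots) - 1"
    using aff_dim_eq_dim_subtract R(4) by metis
  have span: "?L \<subseteq> span simple_roots"
  proof
    fix x assume "x \<in> ?L"
    then obtain t where t: "t \<in> R" "x = t b - r b" by (auto simp: orbit_points_def)
    have "(t b - b) - (r b - b) \<in> span simple_roots"
      using t(1) r RW by (intro span_diff group_preserves_span) auto
    then show "x \<in> span simple_roots" using t(2) by simp
  qed
  have orth: "x \<bullet> y = 0" if x: "x \<in> ?L" and y: "y \<in> {v, w}" for x y
  proof -
    obtain t where t: "t \<in> R" "x = t b - r b" using x by (auto simp: orbit_points_def)
    have "v \<bullet> t b = c b" "v \<bullet> r b = c b" "w \<bullet> t b = e b" "w \<bullet> r b = e b"
      using t(1) r R(1,2) RW bspec[OF vD base_point] bspec[OF wE base_point] by blast+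
    then have "y \<bullet> x = 0" using y t(2) by (auto simp: inner_diff_right)
    then show ?thesis by (simp add: inner_commute)
  qed
  have "dim ?L + dim {v, w} = dim (?L \<union> {v, w})"
    using dim_orthogonal_sum[of ?L "{v, w}"] orth by simp
  also have "\<dots> \<le> dim (span simple_roots)"
    using span v(1) w(1) by (intro dim_subset) auto
  also have "\<dots> = card simple_roots"
    using dim_eq_card_independent[OF independent_simple_roots] by simp
  \<comment> \<open>The directions of the base fill all but one dimension of the span of the roots.\<close>
  finally have "dim {v, w} \<le> 1" using dimL by linarith
  then have "v \<in> span {w}" using w(2) by (auto simp: dim_insert split: if_splits)
  then obtain k where k: "v = k *\<^sub>R w" by (auto simp: span_singleton)
  fix u assume u: "u \<in> E"
  have uW: "u \<in> W" "r \<in> W" using u r RW coset_subset[OF \<beta>(2)] by auto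
  have "w \<bullet> u b = w \<bullet> r b" using bspec[OF wE base_point] uW u r R(2) by auto
  then have "v \<bullet> u b = v \<bullet> r b" by (simp add: k)
  then show "u \<in> D" using bspec[OF vD base_point] uW r R(1) by auto
qed

lemma base_determines_coset:
  assumes \<alpha>: "\<alpha> \<in> simple_roots" "D \<in> parabolic_cosets \<alpha>" "R \<in> persistent_bases D"
    and \<beta>: "\<beta> \<in> simple_roots" "E \<in> parabolic_cosets \<beta>" "R \<in> persistent_bases E"
  shows "D = E" and "\<alpha> = \<beta>"
proof -
  show DE: "D = E"
    using base_determines_coset_aux[OF \<alpha> \<beta>] base_determines_coset_aux[OF \<beta> \<alpha>] by blast
  \<comment> \<open>\<open>D\<close> is stable under right multiplication by both subgroups; if \<open>\<alpha> \<noteq> \<beta>\<close>, the reflection in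
    \<open>\<alpha>\<close> lies in that of \<open>\<beta>\<close>, hence also in that of \<open>\<alpha>\<close>, although it moves the weight of \<open>\<alpha>\<close>.\<close>
  show "\<alpha> = \<beta>"
  proof (rule ccontr)
    assume "\<alpha> \<noteq> \<beta>"
    then have s: "reflection \<alpha> \<in> parabolic \<beta>"
      unfolding parabolic_def using \<alpha>(1) by (intro image_eqI[of _ _ "[\<alpha>]"]) auto
    obtain w where w: "w \<in> W" "D = (\<circ>) w ` parabolic \<alpha>"
      using \<alpha>(2) by (auto simp: parabolic_cosets_def)
    have "w \<circ> id \<in> D" unfolding w(2) by (rule imageI[OF id_in_parabolic])
    then have "w \<circ> reflection \<alpha> \<in> D" using coset_comp_right[OF \<beta>(2) _ s] DE by simp
    then obtain p where p: "p \<in> parabolic \<alpha>" "w \<circ> reflection \<alpha> = w \<circ> p" using w(2) by auto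
    have "reflection \<alpha> = p"
      by (rule inj_onD[OF inj_on_comp_left[OF w(1)]]) (rule p(2), rule UNIV_I, rule UNIV_I)
    then have mem: "reflection \<alpha> \<in> parabolic \<alpha>" using p(1) by simp
    obtain \<omega> where \<omega>: "0 < \<alpha> \<bullet> \<omega>" "\<forall>\<beta>\<in>simple_roots - {\<alpha>}. \<beta> \<bullet> \<omega> = 0"
      using fundamental_weight[OF \<alpha>(1)] by blast
    have "reflection \<alpha> \<omega> = \<omega>"
      using stabilizer_fundamental_weight[OF \<alpha>(1) \<omega> reflection_root[OF simple_root_is_root[OF \<alpha>(1)]]]
        mem by simp
    then have "reflection \<alpha> \<omega> \<bullet> \<alpha> = \<omega> \<bullet> \<alpha>" by simp
    then show False
      using \<omega>(1) inner_root_self[OF simple_root_is_root[OF \<alpha>(1)]]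
      unfolding inner_reflection by (simp add: inner_commute)
  qed
qed

text \<open>
  The set \<open>Q\<close> consists of the pyramids with a marked facet, base and apex, the set \<open>M\<close> of the
  persistent simplices with a marked vertex. Forgetting the facet and the base maps \<open>Q\<close>
  injectively into \<open>M\<close>, since both can be recovered from the simplex and its apex.
\<close>

lemma pyramid_count:
  assumes C: "\<And>\<alpha>. \<alpha> \<in> simple_roots \<Longrightarrow> chamber (parabolic \<alpha>) (C \<alpha>)"
  shows "(\<Sum>\<alpha>\<in>simple_roots. card (parabolic_cosets \<alpha>) *
            (PersistS (parabolic \<alpha>) (C \<alpha>) * (card W - card (parabolic \<alpha>))))
         \<le> (card simple_roots + 1) * PersistS W B"
proof -
  define Q where "Q = (SIGMA \<alpha>:simple_roots. SIGMA D:parabolic_cosets \<alpha>. persistent_bases D \<times> (W - D))"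
  define M where "M = (SIGMA T:{T. persistent_simplex W B T}. T)"
  define f where "f = (\<lambda>(\<alpha>::'a, D::('a \<Rightarrow> 'a) set, R, u::'a \<Rightarrow> 'a). (insert u R, u))"
  have finT: "finite T" if "persistent_simplex W B T" for T
    using that finite_group finite_subset by (auto simp: persistent_simplex_def)
  have finC: "finite (parabolic_cosets \<alpha>)" for \<alpha>
    using finite_group by (simp add: parabolic_cosets_def)
  have finB: "finite (persistent_bases D \<times> (W - D))" if "D \<in> parabolic_cosets \<alpha>" for D \<alpha>
    using finite_persistent_bases[OF coset_subset[OF that]] finite_group by simp
  have "(\<Sum>\<alpha>\<in>simple_roots. card (parabolic_cosets \<alpha>) *
            (PersistS (parabolic \<alpha>) (C \<alpha>) * (card W - card (parabolic \<alpha>))))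
      = (\<Sum>\<alpha>\<in>simple_roots. \<Sum>D\<in>parabolic_cosets \<alpha>.
            PersistS (parabolic \<alpha>) (C \<alpha>) * (card W - card (parabolic \<alpha>)))"
    by simp
  also have "\<dots> \<le> (\<Sum>\<alpha>\<in>simple_roots. \<Sum>D\<in>parabolic_cosets \<alpha>. card (persistent_bases D \<times> (W - D)))"
  proof (intro sum_mono)
    fix \<alpha> D assume \<alpha>: "\<alpha> \<in> simple_roots" and D: "D \<in> parabolic_cosets \<alpha>"
    have "PersistS (parabolic \<alpha>) (C \<alpha>) \<le> card (persistent_bases D)"
      using PersistS_parabolic_le[OF \<alpha> C[OF \<alpha>]] card_persistent_bases_coset[OF D] by linarith
    moreover have "card (W - D) = card W - card (parabolic \<alpha>)"
      using coset_subset[OF D] finite_group card_coset[OF D] by (simp add: card_Diff_subset finite_subset)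
    ultimately show "PersistS (parabolic \<alpha>) (C \<alpha>) * (card W - card (parabolic \<alpha>))
        \<le> card (persistent_bases D \<times> (W - D))"
      by (simp add: card_cartesian_product)
  qed
  also have "\<dots> = card Q"
    unfolding Q_def using finite_simple_roots finC finB by (simp add: card_SigmaI)
  also have "\<dots> \<le> card M"
  proof (rule card_inj_on_le)
    show "inj_on f Q"
    proof (rule inj_onI)
      fix x y assume "x \<in> Q" "y \<in> Q" "f x = f y"
      then obtain \<alpha> D R u \<beta> E R' where
        x: "x = (\<alpha>, D, R, u)" "\<alpha> \<in> simple_roots" "D \<in> parabolic_cosets \<alpha>"
          "R \<in> persistent_bases D" "u \<in> W - D" and
        y: "y = (\<beta>, E, R', u)" "\<beta> \<in> simple_roots" "E \<in> parabolic_cosets \<beta>"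
          "R' \<in> persistent_bases E" "u \<in> W - E" and eq: "insert u R = insert u R'"
        by (auto simp: Q_def f_def)
      have "u \<notin> R" "u \<notin> R'" using x(4,5) y(4,5) by (auto simp: persistent_bases_def)
      then have "R = R'" using eq by (metis insert_ident)
      then show "x = y"
        using base_determines_coset[OF x(2-4) y(2,3)] x(1) y(1,4) by simp
    qed
    show "f ` Q \<subseteq> M"
      using pyramid_persistent by (fastforce simp: Q_def f_def M_def)
    show "finite M" using finite_persistent_simplices finT by (auto simp: M_def)
  qed
  also have "card M = (\<Sum>T\<in>{T. persistent_simplex W B T}. card T)"
    unfolding M_def using finite_persistent_simplices finT by (intro card_SigmaI) auto
  also have "\<dots> = (card simple_roots + 1) * PersistS W B"
    by (simp add: persistent_simplex_iff PersistS_def)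
  finally show ?thesis .
qed

end

section \<open>The recursive lower bound\<close>

lemma PersistS_trivial:
  assumes "chamber {id :: 'a::euclidean_space \<Rightarrow> 'a} B"
  shows "PersistS {id :: 'a \<Rightarrow> 'a} B = 1"
proof -
  have "reflection \<alpha> \<noteq> id" if "norm \<alpha> = 1" for \<alpha> :: 'a
  proof
    assume "reflection \<alpha> = id"
    then have "- \<alpha> = \<alpha>" using reflection_self[of \<alpha>] by simp
    then have "\<alpha> + \<alpha> = 0" by (metis add.right_inverse)
    then have "2 *\<^sub>R \<alpha> = 0" by (simp only: scaleR_2)
    with that show False by simp
  qed
  then have "roots {id :: 'a \<Rightarrow> 'a} = {}" by (auto simp: roots_def)
  then have rank: "reflection_rank {id :: 'a \<Rightarrow> 'a} B = 0"
    by (simp add: reflection_rank_def simple_reflections_def wall_root_def)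
  have "persistent_simplex {id :: 'a \<Rightarrow> 'a} B T \<longleftrightarrow> T = {id}" for T
    by (auto simp: persistent_simplex_def rank card_1_singleton_iff)
  then show ?thesis by (simp add: PersistS_def)
qed

theorem corollary6p2:
  fixes W :: "('a::euclidean_space \<Rightarrow> 'a) set"
    and B B0 :: "'a set"
    and C :: "('a \<Rightarrow> 'a) \<Rightarrow> 'a set"
    and S :: "('a \<Rightarrow> 'a) set"
    and Wp :: "('a \<Rightarrow> 'a) \<Rightarrow> ('a \<Rightarrow> 'a) set"
    and d :: nat
  assumes "finite_reflection_group W"
    and "chamber W B"
    and "S = simple_reflections W B"
    and "d = card S"
    and "\<And>s. Wp s = max_parabolic W B s"
    and "\<And>s. s \<in> S \<Longrightarrow> chamber (Wp s) (C s)"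
    and "chamber {id} B0"
  shows "(d \<ge> 1 \<longrightarrow>
            real (PersistS W B) \<ge>
              1 / (real d + 1) *
                (\<Sum>s\<in>S. real (card W) / real (card (Wp s)) *
                        (real (card W) - real (card (Wp s))) *
                        real (PersistS (Wp s) (C s))))
         \<and> PersistS {id :: 'a \<Rightarrow> 'a} B0 = 1"
proof
  show "PersistS {id :: 'a \<Rightarrow> 'a} B0 = 1" using PersistS_trivial[OF assms(7)] .
  obtain b where b: "b \<in> B" using in_components_nonempty[OF assms(2)[unfolded chamber_def]] by blast
  interpret reflection_chamber W B b
    by (rule reflection_chamber.intro[OF assms(1,2) b])
  have S: "S = reflection ` simple_roots" by (simp add: assms(3) simple_reflections_eq)
  have d: "d = card simple_roots" by (simp add: assms(4) S card_image inj_on_reflection_simple)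
  have Wp: "Wp (reflection \<alpha>) = parabolic \<alpha>" if "\<alpha> \<in> simple_roots" for \<alpha>
    using that by (simp add: assms(5) max_parabolic_eq)
  let ?term = "\<lambda>s. real (card W) / real (card (Wp s)) *
      (real (card W) - real (card (Wp s))) * real (PersistS (Wp s) (C s))"
  let ?count = "\<lambda>\<alpha>. card (parabolic_cosets \<alpha>) *
      (PersistS (parabolic \<alpha>) (C (reflection \<alpha>)) * (card W - card (parabolic \<alpha>)))"
  have "?term (reflection \<alpha>) = real (?count \<alpha>)" if \<alpha>: "\<alpha> \<in> simple_roots" for \<alpha>
  proof -
    have "card (parabolic \<alpha>) \<noteq> 0" using id_in_parabolic finite_parabolic by auto
    then have "real (card W) / real (card (parabolic \<alpha>)) = real (card (parabolic_cosets \<alpha>))"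
      using card_group[of \<alpha>] by simp
    moreover have "real (card W - card (parabolic \<alpha>)) = real (card W) - real (card (parabolic \<alpha>))"
      using card_mono[OF finite_group parabolic_subset] by (rule of_nat_diff)
    ultimately show ?thesis by (simp add: Wp[OF \<alpha>])
  qed
  then have "(\<Sum>s\<in>S. ?term s) = real (\<Sum>\<alpha>\<in>simple_roots. ?count \<alpha>)"
    unfolding S by (simp add: sum.reindex inj_on_reflection_simple)
  also have "\<dots> \<le> real ((card simple_roots + 1) * PersistS W B)"
    using assms(6) by (intro of_nat_mono pyramid_count) (simp add: S flip: Wp)
  finally have "(\<Sum>s\<in>S. ?term s) \<le> (real d + 1) * real (PersistS W B)" by (simp add: d algebra_simps)
  then show "d \<ge> 1 \<longrightarrow> real (PersistS W B) \<ge> 1 / (real d + 1) * (\<Sum>s\<in>S. ?term s)"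
    by (simp add: divide_le_eq mult.commute)
qed

end
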